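(* Let $0<p<\infty$, $0<q\le\infty$ and $s>0$. There exist constants $c_1,c_2>0$ such that for all $0<\lambda\le 1$ and all $f\in \mathbf{F}^s_{p,q}(\mathbb{R}^n)$ with $\operatorname{supp} f\subset B_\lambda$, $$c_1\,\lambda^{s-\frac np}\,\|f|\mathbf{F}^s_{p,q}(\mathbb{R}^n)\|\le \|f(\lambda\,\cdot)|\mathbf{F}^s_{p,q}(\mathbb{R}^n)\|\le c_2\,\lambda^{s-\frac np}\,\|f|\mathbf{F}^s_{p,q}(\mathbb{R}^n)\|,$$ i.e. the two sides are equivalent with constants of equivalence independent of $\lambda$ and $f$.
   Context: $B_R=\{x\in\mathbb{R}^n:|x|<R\}$ for $R>0$. For $h\in\mathbb{R}^n$, $r\in\mathbb{N}$, the iterated differences are $(\Delta_h^1f)(x)=f(x+h)-f(x)$ and $(\Delta_h^{r+1}f)(x)=\Delta_h^1(\Delta_h^rf)(x)$. For $f\in L_p(\mathbb{R}^n)$, $0<p<\infty$, $t>0$, the ball means are $$d^r_{t,p}f(x)=\Big(t^{-n}\int_{|h|\le t}|(\Delta_h^rf)(x)|^p\,dh\Big)^{1/p}.$$ For $0<p<\infty$, $0<q\le\infty$, $s>0$ and $r\in\mathbb{N}$ with $r>s$, the Triebel-Lizorkin space $\mathbf{F}^s_{p,q}(\mathbb{R}^n)$ consists of all $f\in L_p(\mathbb{R}^n)$ such that $$\|f|\mathbf{F}^s_{p,q}(\mathbb{R}^n)\|=\|f|L_p(\mathbb{R}^n)\|+\Big\|\Big(\int_0^1t^{-sq}\,d^r_{t,p}f(\cdot)^q\,\frac{dt}{t}\Big)^{1/q}\Big|L_p(\mathbb{R}^n)\Big\|$$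 is finite (with the usual supremum modification if $q=\infty$), where $\|\cdot|L_p\|$ is the usual $L_p$ (quasi-)norm. Different choices of $r>s$ give equivalent quasi-norms, and replacing $\int_0^1$ by $\int_0^\infty$ also gives an equivalent quasi-norm; $r$ is fixed and suppressed in the notation. The constants may depend on $n,s,p,q,r$. *)

theory Defs
  imports "HOL-Analysis.Analysis"
begin

text \<open>All (quasi-)norms and the quantities entering them take values in \<^typ>\<open>ennreal\<close>, with
  \<open>\<infinity>\<close> meaning that the integral diverges. The power \<open>x\<^sup>a\<close> is only used for \<open>a > 0\<close>,
  so \<open>\<infinity>\<^sup>a = \<infinity>\<close>.\<close>

definition epowr :: "ennreal \<Rightarrow> real \<Rightarrow> ennreal" where
  "epowr x a = (if x = \<infinity> then \<infinity> else ennreal (enn2real x powr a))"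

definition Lp_norm :: "real \<Rightarrow> (real^'n \<Rightarrow> ennreal) \<Rightarrow> ennreal" where
  "Lp_norm p g = epowr (\<integral>\<^sup>+x. epowr (g x) p \<partial>lebesgue) (1 / p)"

definition Lp_space :: "real \<Rightarrow> (real^'n \<Rightarrow> complex) set" where
  "Lp_space p =
     {f. f \<in> borel_measurable lebesgue \<and> Lp_norm p (\<lambda>x. ennreal (norm (f x))) < \<infinity>}"

definition iter_diff :: "nat \<Rightarrow> real^'n \<Rightarrow> (real^'n \<Rightarrow> complex) \<Rightarrow> real^'n \<Rightarrow> complex" where
  "iter_diff r h f = ((\<lambda>g x. g (x + h) - g x) ^^ r) f"

definition ball_mean ::
    "nat \<Rightarrow> real \<Rightarrow> real \<Rightarrow> (real^'n \<Rightarrow> complex) \<Rightarrow> real^'n \<Rightarrow> ennreal" where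
  "ball_mean r p t f x =
     epowr (ennreal (t powr (- real CARD('n))) *
       (\<integral>\<^sup>+h\<in>cball 0 t. ennreal (norm (iter_diff r h f x) powr p) \<partial>lebesgue)) (1 / p)"

definition TL_inner ::
    "nat \<Rightarrow> real \<Rightarrow> real \<Rightarrow> ennreal \<Rightarrow> (real^'n \<Rightarrow> complex) \<Rightarrow> real^'n \<Rightarrow> ennreal" where
  "TL_inner r s p q f x =
     (if q = \<infinity> then (SUP t\<in>{0<..1}. ennreal (t powr (- s)) * ball_mean r p t f x)
      else epowr
        (\<integral>\<^sup>+t\<in>{0<..1}. ennreal (t powr (- (s * enn2real q))) *
           epowr (ball_mean r p t f x) (enn2real q) * ennreal (1 / t) \<partial>lebesgue)
        (1 / enn2real q))"

definition TL_norm ::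
    "nat \<Rightarrow> real \<Rightarrow> real \<Rightarrow> ennreal \<Rightarrow> (real^'n \<Rightarrow> complex) \<Rightarrow> ennreal" where
  "TL_norm r s p q f =
     Lp_norm p (\<lambda>x. ennreal (norm (f x))) + Lp_norm p (TL_inner r s p q f)"

definition TL_space ::
    "nat \<Rightarrow> real \<Rightarrow> real \<Rightarrow> ennreal \<Rightarrow> (real^'n \<Rightarrow> complex) set" where
  "TL_space r s p q = {f \<in> Lp_space p. TL_norm r s p q f < \<infinity>}"

text \<open>Elements of \<open>L\<^sub>p\<close> are represented by measurable functions and never identified
  modulo null sets, so the support has to be the essential one: the complement of the largest
  open set on which the function vanishes almost everywhere.\<close>

definition ess_supp :: "(real^'n \<Rightarrow> complex) \<Rightarrow> (real^'n) set" where
  "ess_supp f = - \<Union>{U. open U \<and> (AE x in lebesgue. x \<in> U \<longrightarrow> f x = 0)}"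

end

theory Submission
  imports Defs
begin

text \<open>
  Let \<open>g x = f (l x)\<close>. Differences of \<open>g\<close> with step \<open>h\<close> are differences of \<open>f\<close> with step \<open>l h\<close>, so the
  substitutions \<open>h \<mapsto> l h\<close>, \<open>t \<mapsto> l t\<close> and \<open>x \<mapsto> l x\<close> show that the norm of \<open>g\<close> equals
  \<open>l powr (- n / p)\<close> times the \<open>L\<^sub>p\<close>-norm of \<open>f\<close> plus \<open>l powr (s - n / p)\<close> times the \<open>L\<^sub>p\<close>-norm of
  the square function of \<open>f\<close> over the scales \<open>0 < t \<le> l\<close> only (\<open>TL_norm_dilate\<close>). Compared with
  \<open>l powr (s - n / p)\<close> times the norm of \<open>f\<close>, the first term has an excess factor \<open>l powr - s\<close>,
  and the scales between \<open>l\<close> and 1 are missing from the second. The hypothesis that \<open>f\<close> is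
  supported in the ball of radius \<open>l\<close> settles both.

  For the upper estimate, \<open>l powr - s\<close> times the \<open>L\<^sub>p\<close>-norm of \<open>f\<close> has to be bounded by the norm of
  \<open>f\<close>. If \<open>x\<close> lies in the ball and \<open>norm h \<ge> 2 l\<close>, then \<open>x + h, x + 2 h, \<dots>\<close> lie outside of it and
  the difference at \<open>x\<close> is \<open>\<plusminus>f x\<close>. Hence the ball means at scales between \<open>3 l\<close> and \<open>4 l\<close> dominate
  \<open>norm (f x)\<close> pointwise, and these scales alone give the claim if \<open>4 l \<le> 1\<close>
  (\<open>Lp_norm_le_TL_inner\<close>). For \<open>l > 1 / 4\<close> the factor \<open>l powr - s\<close> is bounded.

  For the lower estimate, the missing scales are bounded by \<open>l powr - s\<close> times the \<open>L\<^sub>p\<close>-norm of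
  \<open>f\<close> (\<open>TL_inner_le_small_scales\<close>). For \<open>t \<ge> l\<close> the ball mean at \<open>x\<close> is at most a constant times
  \<open>norm (f x)\<close> plus, only if \<open>norm x \<le> (r + 1) t\<close>, the \<open>L\<^sub>p\<close>-norm of \<open>f\<close> times \<open>t powr (- n / p)\<close>.
  Integrating over \<open>t\<close> gives \<open>l powr - s * norm (f x)\<close> and the \<open>L\<^sub>p\<close>-norm of \<open>f\<close> times
  \<open>max l (norm x / (r + 1)) powr (- s - n / p)\<close>. The \<open>L\<^sub>p\<close>-norm of this last weight is a constant
  times \<open>l powr - s\<close>.

  The argument is uniform in \<open>p\<close> and \<open>q\<close>, since all triangle inequalities are used with constants.
  Integrals of functions not known to be measurable, such as suprema over \<open>t\<close>, are read as
  lower integrals; these are monotone, transform correctly under dilations, and are subadditive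
  when one of the two summands is measurable.\<close>

section \<open>Powers of extended nonnegative numbers\<close>

lemma epowr_mono: "x \<le> y \<Longrightarrow> 0 \<le> a \<Longrightarrow> epowr x a \<le> epowr y a"
  by (auto simp: epowr_def top_unique less_top enn2real_mono intro!: ennreal_leI powr_mono2)

lemma epowr_ennreal: "0 \<le> u \<Longrightarrow> epowr (ennreal u) a = ennreal (u powr a)"
  by (simp add: epowr_def)

lemma epowr_0 [simp]: "epowr 0 a = 0"
  by (simp add: epowr_def)

lemma epowr_mult: "epowr (x * y) a = epowr x a * epowr y a"
  by (cases x; cases y)
    (auto simp: epowr_def ennreal_mult_top ennreal_top_mult ennreal_mult_eq_top_iff enn2real_mult powr_mult ennreal_mult)

lemma epowr_epowr: "epowr (epowr x a) b = epowr x (a * b)"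
  by (cases x) (auto simp: epowr_def powr_powr)

lemma epowr_one [simp]: "epowr x 1 = x"
  by (cases x) (auto simp: epowr_def)

text \<open>The constant comes from \<open>x + y \<le> 2 max x y\<close>, which works for \<open>a < 1\<close> and \<open>a \<ge> 1\<close> alike.\<close>

lemma epowr_add_le:
  assumes "0 < a"
  shows "epowr (x + y) a \<le> ennreal (2 powr a) * (epowr x a + epowr y a)"
proof -
  have "x + y \<le> 2 * max x y"
    by (cases "x \<le> y") (auto simp: max_def mult_2 add_mono)
  then have "epowr (x + y) a \<le> epowr (ennreal 2 * max x y) a"
    using assms by (intro epowr_mono) auto
  also have "\<dots> = ennreal (2 powr a) * epowr (max x y) a"
    by (simp only: epowr_mult) (simp add: epowr_ennreal del: ennreal_numeral)
  also have "\<dots> \<le> ennreal (2 powr a) * (epowr x a + epowr y a)"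
    by (intro mult_left_mono) (auto simp: max_def add_increasing add_increasing2)
  finally show ?thesis .
qed

lemma borel_measurable_epowr [measurable (raw)]:
  assumes [measurable]: "g \<in> borel_measurable M"
  shows "(\<lambda>x. epowr (g x) a) \<in> borel_measurable M"
  unfolding epowr_def by measurable

section \<open>Lower integrals\<close>

text \<open>The integral of a function that need not be measurable is the supremum over the simple functions
  below it, that is, a lower integral. It remains subadditive as long as one summand is
  measurable: a simple function \<open>u \<le> a + b\<close> is at most \<open>(u - b) + b\<close>, where \<open>u - b\<close> is a
  measurable minorant of \<open>a\<close>. It is applied with a square function or a supremum over \<open>t\<close>
  as \<open>a\<close> and an explicit majorant as \<open>b\<close>.\<close>

lemma nn_integral_add_le:
  assumes [measurable]: "b \<in> borel_measurable M"
  shows "(\<integral>\<^sup>+x. a x + b x \<partial>M) \<le> (\<integral>\<^sup>+x. a x \<partial>M) + (\<integral>\<^sup>+x. b x \<partial>M)"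
  unfolding nn_integral_def_finite[of M "\<lambda>x. a x + b x"]
proof (rule SUP_least, clarify)
  fix u :: "'a \<Rightarrow> ennreal"
  assume u: "simple_function M u" "u \<le> (\<lambda>x. a x + b x)" "\<forall>x. u x < top"
  have [measurable]: "u \<in> borel_measurable M"
    using u(1) by (rule borel_measurable_simple_function)
  have "integral\<^sup>S M u = (\<integral>\<^sup>+x. u x \<partial>M)"
    using u(1) by (simp add: nn_integral_eq_simple_integral)
  also have "\<dots> \<le> (\<integral>\<^sup>+x. (u x - b x) + b x \<partial>M)"
    by (intro nn_integral_mono) (metis add.commute ennreal_minus_le_iff order_refl)
  also have "\<dots> = (\<integral>\<^sup>+x. u x - b x \<partial>M) + (\<integral>\<^sup>+x. b x \<partial>M)"
    by (intro nn_integral_add) auto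
  also have "\<dots> \<le> (\<integral>\<^sup>+x. a x \<partial>M) + (\<integral>\<^sup>+x. b x \<partial>M)"
    using u(2,3) by (intro add_right_mono nn_integral_mono)
      (auto simp: ennreal_minus_le_iff le_fun_def add.commute less_top[symmetric])
  finally show "integral\<^sup>S M u \<le> (\<integral>\<^sup>+x. a x \<partial>M) + (\<integral>\<^sup>+x. b x \<partial>M)" .
qed

text \<open>Multiplication by \<open>c\<close> maps the simple minorants of \<open>a\<close> onto those of \<open>c a\<close>; one inequality is
  shown for all \<open>c\<close> and \<open>a\<close>, and applied to \<open>1 / c\<close> it gives the other one.\<close>

lemma nn_integral_cmult_pos:
  assumes "0 < c"
  shows "(\<integral>\<^sup>+x. ennreal c * a x \<partial>M) = ennreal c * (\<integral>\<^sup>+x. a x \<partial>M)"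
proof -
  have le: "ennreal c * (\<integral>\<^sup>+x. a x \<partial>M) \<le> (\<integral>\<^sup>+x. ennreal c * a x \<partial>M)" if "0 < c" for c a
    unfolding nn_integral_def[of M a] SUP_mult_left_ennreal
  proof (rule SUP_least, clarify)
    fix u :: "'a \<Rightarrow> ennreal"
    assume u: "simple_function M u" "u \<le> a"
    then have [measurable]: "u \<in> borel_measurable M"
      by (intro borel_measurable_simple_function)
    have "ennreal c * integral\<^sup>S M u = (\<integral>\<^sup>+x. ennreal c * u x \<partial>M)"
      using u(1) by (simp add: nn_integral_eq_simple_integral nn_integral_cmult)
    also have "\<dots> \<le> (\<integral>\<^sup>+x. ennreal c * a x \<partial>M)"
      using u(2) by (intro nn_integral_mono mult_left_mono) (auto simp: le_fun_def)
    finally show "ennreal c * integral\<^sup>S M u \<le> (\<integral>\<^sup>+x. ennreal c * a x \<partial>M)" .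
  qed
  have inv: "ennreal c * (ennreal (1 / c) * y) = y" "ennreal (1 / c) * (ennreal c * y) = y" for y
    using assms by (simp_all add: mult.assoc[symmetric] ennreal_mult[symmetric])
  have "ennreal (1 / c) * (\<integral>\<^sup>+x. ennreal c * a x \<partial>M) \<le> (\<integral>\<^sup>+x. a x \<partial>M)"
    using le[of "1 / c" "\<lambda>x. ennreal c * a x"] assms by (simp add: inv)
  then have "ennreal c * (ennreal (1 / c) * (\<integral>\<^sup>+x. ennreal c * a x \<partial>M)) \<le> ennreal c * (\<integral>\<^sup>+x. a x \<partial>M)"
    by (rule mult_left_mono) simp
  then show ?thesis
    using le[OF assms, of a] by (simp add: inv)
qed

section \<open>Affine substitutions in the Lebesgue integral\<close>

lemma lebesgue_affine_eq:
  fixes a :: "'a :: euclidean_space"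
  assumes "c \<noteq> 0"
  shows "lebesgue = density (distr lebesgue lebesgue (\<lambda>x. a + c *\<^sub>R x)) (\<lambda>_. ennreal (\<bar>c\<bar> ^ DIM('a)))"
proof -
  have *: "(\<lambda>x. a + (\<Sum>j\<in>Basis. (c * (x \<bullet> j)) *\<^sub>R j)) = (\<lambda>x. a + c *\<^sub>R x)"
    by (simp add: fun_eq_iff scaleR_scaleR[symmetric] scaleR_sum_right[symmetric] euclidean_representation del: scaleR_scaleR)
  show ?thesis
    using lebesgue_affine_euclidean[where c = "\<lambda>_. c" and t = a] assms
    unfolding * by simp
qed

lemma lebesgue_measurable_affine:
  fixes a :: "'a :: euclidean_space"
  assumes "c \<noteq> 0"
  shows "(\<lambda>x. a + c *\<^sub>R x) \<in> lebesgue \<rightarrow>\<^sub>M lebesgue"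
proof -
  have *: "(\<lambda>x. a + (\<Sum>j\<in>Basis. (c * (x \<bullet> j)) *\<^sub>R j)) = (\<lambda>x. a + c *\<^sub>R x)"
    by (simp add: fun_eq_iff scaleR_scaleR[symmetric] scaleR_sum_right[symmetric] euclidean_representation del: scaleR_scaleR)
  show ?thesis
    using lebesgue_affine_measurable[where c = "\<lambda>_. c" and t = a] assms unfolding * by simp
qed

text \<open>For measurable functions this is the transformation formula. The substitution maps simple
  minorants to simple minorants, so the formula survives for lower integrals; the converse
  inequality is the same one for the inverse affine map.\<close>

lemma nn_integral_lebesgue_affine:
  fixes a :: "'a :: euclidean_space" and G :: "'a \<Rightarrow> ennreal"
  assumes "c \<noteq> 0"
  shows "(\<integral>\<^sup>+x. G x \<partial>lebesgue) = ennreal (\<bar>c\<bar> ^ DIM('a)) * (\<integral>\<^sup>+x. G (a + c *\<^sub>R x) \<partial>lebesgue)"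
proof -
  have meas: "(\<integral>\<^sup>+x. u x \<partial>lebesgue) = ennreal (\<bar>c\<bar> ^ DIM('a)) * (\<integral>\<^sup>+x. u (a + c *\<^sub>R x) \<partial>lebesgue)"
    if u[measurable]: "u \<in> borel_measurable lebesgue" and "c \<noteq> 0"
    for u :: "'a \<Rightarrow> ennreal" and c and a :: 'a
  proof -
    have [measurable]: "(\<lambda>x. a + c *\<^sub>R x) \<in> lebesgue \<rightarrow>\<^sub>M lebesgue"
      using that(2) by (rule lebesgue_measurable_affine)
    show ?thesis
      by (subst lebesgue_affine_eq[OF that(2), of a])
        (simp add: nn_integral_density nn_integral_distr nn_integral_cmult)
  qed
  have le: "(\<integral>\<^sup>+x. G x \<partial>lebesgue) \<le> ennreal (\<bar>c\<bar> ^ DIM('a)) * (\<integral>\<^sup>+x. G (a + c *\<^sub>R x) \<partial>lebesgue)"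
    if "c \<noteq> 0" for G c and a :: 'a
    unfolding nn_integral_def[of _ G]
  proof (rule SUP_least, clarify)
    fix u :: "'a \<Rightarrow> ennreal"
    assume u: "simple_function lebesgue u" "u \<le> G"
    have "integral\<^sup>S lebesgue u = ennreal (\<bar>c\<bar> ^ DIM('a)) * (\<integral>\<^sup>+x. u (a + c *\<^sub>R x) \<partial>lebesgue)"
      using u(1) that by (simp add: nn_integral_eq_simple_integral[symmetric] meas[symmetric]
          borel_measurable_simple_function)
    also have "\<dots> \<le> ennreal (\<bar>c\<bar> ^ DIM('a)) * (\<integral>\<^sup>+x. G (a + c *\<^sub>R x) \<partial>lebesgue)"
      using u(2) by (intro nn_integral_mono mult_left_mono) (auto simp: le_fun_def)
    finally show "integral\<^sup>S lebesgue u \<le> ennreal (\<bar>c\<bar> ^ DIM('a)) * (\<integral>\<^sup>+x. G (a + c *\<^sub>R x) \<partial>lebesgue)" .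
  qed
  have "(\<integral>\<^sup>+x. G (a + c *\<^sub>R x) \<partial>lebesgue) \<le> ennreal (\<bar>1 / c\<bar> ^ DIM('a)) *
      (\<integral>\<^sup>+x. G (a + c *\<^sub>R (- (1 / c) *\<^sub>R a + (1 / c) *\<^sub>R x)) \<partial>lebesgue)"
    using assms by (intro le) simp
  also have "(\<lambda>x. G (a + c *\<^sub>R (- (1 / c) *\<^sub>R a + (1 / c) *\<^sub>R x))) = G"
    using assms by (simp add: fun_eq_iff algebra_simps)
  finally have "ennreal (\<bar>c\<bar> ^ DIM('a)) * (\<integral>\<^sup>+x. G (a + c *\<^sub>R x) \<partial>lebesgue)
      \<le> ennreal (\<bar>c\<bar> ^ DIM('a)) * (ennreal (\<bar>1 / c\<bar> ^ DIM('a)) * (\<integral>\<^sup>+x. G x \<partial>lebesgue))"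
    by (rule mult_left_mono) simp
  also have "\<dots> = (\<integral>\<^sup>+x. G x \<partial>lebesgue)"
    using assms by (simp add: mult.assoc[symmetric] ennreal_mult[symmetric] power_mult_distrib[symmetric]
        abs_mult[symmetric])
  finally show ?thesis
    using le[OF assms, of G a] by (rule antisym[rotated])
qed

lemma AE_lebesgue_affine:
  fixes a :: "'a :: euclidean_space"
  assumes "AE x in lebesgue. P x" "c \<noteq> 0"
  shows "AE x in lebesgue. P (a + c *\<^sub>R x)"
proof -
  let ?T = "\<lambda>x::'a. a + c *\<^sub>R x"
  have "AE x in density (distr lebesgue lebesgue ?T) (\<lambda>_. ennreal (\<bar>c\<bar> ^ DIM('a))). P x"
    using assms(1) by (subst lebesgue_affine_eq[OF assms(2), of a, symmetric])
  then have "AE x in distr lebesgue lebesgue ?T. P x"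
    using assms(2) by (subst (asm) AE_density) auto
  then show ?thesis
    by (rule AE_distrD[OF lebesgue_measurable_affine[OF assms(2)]])
qed

section \<open>Essential support\<close>

text \<open>The complement of the essential support is a union of possibly uncountably many open sets on
  which \<open>f\<close> vanishes almost everywhere. By the Lindelof property countably many suffice.\<close>

lemma AE_zero_outside_ess_supp: "AE x in lebesgue. x \<notin> ess_supp f \<longrightarrow> f x = 0"
proof -
  define \<U> where "\<U> = {U. open U \<and> (AE x in lebesgue. x \<in> U \<longrightarrow> f x = 0)}"
  obtain \<V> where \<V>: "\<V> \<subseteq> \<U>" "countable \<V>" "\<Union>\<V> = \<Union>\<U>"
    using Lindelof[of \<U>] unfolding \<U>_def by blast
  have "AE x in lebesgue. \<forall>U\<in>\<V>. x \<in> U \<longrightarrow> f x = 0"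
    using \<V> by (intro AE_ball_countable'[OF _ \<V>(2)]) (auto simp: \<U>_def)
  then show ?thesis
  proof (eventually_elim, clarify)
    fix x assume x: "\<forall>U\<in>\<V>. x \<in> U \<longrightarrow> f x = 0" "x \<notin> ess_supp f"
    then have "x \<in> \<Union>\<V>"
      unfolding \<V>(3) by (simp only: ess_supp_def \<U>_def Compl_iff not_not)
    with x(1) show "f x = 0" by blast
  qed
qed

section \<open>Iterated differences\<close>

lemma iter_diff_0 [simp]: "iter_diff 0 h f = f"
  by (simp add: iter_diff_def)

lemma iter_diff_Suc [simp]: "iter_diff (Suc k) h f x = iter_diff k h f (x + h) - iter_diff k h f x"
  by (simp add: iter_diff_def)

lemma iter_diff_dilate: "iter_diff k h (\<lambda>x. f (l *\<^sub>R x)) x = iter_diff k (l *\<^sub>R h) f (l *\<^sub>R x)"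
  by (induction k arbitrary: x) (simp_all add: scaleR_add_right)

lemma norm_iter_diff_le:
  assumes "\<And>j. j \<le> k \<Longrightarrow> norm (f (x + real j *\<^sub>R h)) \<le> M"
  shows "norm (iter_diff k h f x) \<le> 2 ^ k * M"
  using assms
proof (induction k arbitrary: x)
  case 0
  then show ?case using 0[of 0] by simp
next
  case (Suc k)
  have "norm (iter_diff k h f (x + h)) \<le> 2 ^ k * M"
  proof (rule Suc.IH)
    fix j assume "j \<le> k"
    then show "norm (f (x + h + real j *\<^sub>R h)) \<le> M"
      using Suc.prems[of "Suc j"] by (simp add: algebra_simps)
  qed
  moreover have "norm (iter_diff k h f x) \<le> 2 ^ k * M"
    by (rule Suc.IH) (use Suc.prems in auto)
  ultimately show ?case
    using norm_triangle_ineq4[of "iter_diff k h f (x + h)" "iter_diff k h f x"] by simp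
qed

text \<open>Once the points \<open>x + h, \<dots>, x + k h\<close> have left the support, only the term \<open>\<plusminus>f x\<close> of the
  difference remains. This is what turns differences into a bound for the function itself.\<close>

lemma norm_iter_diff_eq:
  assumes "\<And>j. 1 \<le> j \<Longrightarrow> j \<le> k \<Longrightarrow> f (x + real j *\<^sub>R h) = 0"
  shows "norm (iter_diff k h f x) = norm (f x)"
  using assms
proof (induction k)
  case (Suc k)
  have "norm (iter_diff k h f (x + h)) \<le> 2 ^ k * 0"
  proof (rule norm_iter_diff_le)
    fix j assume "j \<le> k"
    then show "norm (f (x + h + real j *\<^sub>R h)) \<le> 0"
      using Suc.prems[of "Suc j"] by (simp add: algebra_simps)
  qed
  then show ?case
    using Suc by simp
qed simp

section \<open>Power-weighted quasi-norms\<close>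

text \<open>This integral serves twice: for the scales \<open>t \<ge> \<rho>\<close>, and, read from right to left, to write a
  negative power as a superposition of indicator functions.\<close>

lemma nn_integral_powr_tail:
  assumes "0 < a" "0 < \<rho>"
  shows "(\<integral>\<^sup>+t\<in>{\<rho>..}. ennreal (t powr (- a - 1)) \<partial>lebesgue) = ennreal (\<rho> powr - a / a)"
proof -
  have lim: "((\<lambda>t. - (t powr - a / a)) \<longlongrightarrow> - (0 / a)) at_top"
    using assms by (intro tendsto_intros tendsto_neg_powr filterlim_ident) auto
  have "(\<integral>\<^sup>+t. ennreal (t powr (- a - 1)) * indicator {\<rho>..} t \<partial>lborel) = ennreal (- (0 / a) - (- (\<rho> powr - a / a)))"
  proof (rule nn_integral_FTC_atLeast[where F = "\<lambda>t. - (t powr - a / a)", OF _ _ _ lim])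
    fix x assume "\<rho> \<le> x"
    then show "((\<lambda>t. - (t powr - a / a)) has_real_derivative x powr (- a - 1)) (at x)"
      using assms by (auto intro!: derivative_eq_intros simp: field_simps)
  qed auto
  then show ?thesis
    by (simp add: nn_integral_completion)
qed

text \<open>The common source of the quasi-triangle inequalities in \<open>x\<close> (weight 1) and in the scale \<open>t\<close>
  (weight \<open>t powr (- s q - 1)\<close>).\<close>

lemma epowr_nn_integral_add_le:
  assumes "0 < q" and [measurable]: "w \<in> borel_measurable M" "b \<in> borel_measurable M"
  shows "epowr (\<integral>\<^sup>+x. w x * epowr (a x + b x) q \<partial>M) (1 / q)
    \<le> ennreal (2 * 2 powr (1 / q)) * (epowr (\<integral>\<^sup>+x. w x * epowr (a x) q \<partial>M) (1 / q)
        + epowr (\<integral>\<^sup>+x. w x * epowr (b x) q \<partial>M) (1 / q))"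
proof -
  let ?A = "\<integral>\<^sup>+x. w x * epowr (a x) q \<partial>M" and ?B = "\<integral>\<^sup>+x. w x * epowr (b x) q \<partial>M"
  have "(\<integral>\<^sup>+x. w x * epowr (a x + b x) q \<partial>M)
      \<le> (\<integral>\<^sup>+x. ennreal (2 powr q) * (w x * epowr (a x) q + w x * epowr (b x) q) \<partial>M)"
  proof (rule nn_integral_mono)
    fix x
    show "w x * epowr (a x + b x) q \<le> ennreal (2 powr q) * (w x * epowr (a x) q + w x * epowr (b x) q)"
      using mult_left_mono[OF epowr_add_le[OF assms(1), of "a x" "b x"], of "w x"]
      by (simp add: distrib_left mult_ac)
  qed
  also have "\<dots> \<le> ennreal (2 powr q) * (?A + ?B)"
    by (simp add: nn_integral_cmult_pos nn_integral_add_le mult_left_mono)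
  finally have "epowr (\<integral>\<^sup>+x. w x * epowr (a x + b x) q \<partial>M) (1 / q)
      \<le> epowr (ennreal (2 powr q) * (?A + ?B)) (1 / q)"
    using assms(1) by (intro epowr_mono) auto
  also have "\<dots> = ennreal 2 * epowr (?A + ?B) (1 / q)"
    using assms(1) by (simp add: epowr_mult epowr_ennreal powr_powr)
  also have "\<dots> \<le> ennreal 2 * (ennreal (2 powr (1 / q)) * (epowr ?A (1 / q) + epowr ?B (1 / q)))"
    using assms(1) by (intro mult_left_mono epowr_add_le) auto
  also have "\<dots> = ennreal (2 * 2 powr (1 / q)) * (epowr ?A (1 / q) + epowr ?B (1 / q))"
    by (simp add: ennreal_mult mult.assoc)
  finally show ?thesis .
qed

lemma Lp_norm_mono_AE:
  assumes "0 < p" "AE x in lebesgue. a x \<le> b x"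
  shows "Lp_norm p a \<le> Lp_norm p b"
  unfolding Lp_norm_def
proof (rule epowr_mono, rule nn_integral_mono_AE)
  show "AE x in lebesgue. epowr (a x) p \<le> epowr (b x) p"
    using assms(2) by eventually_elim (use assms(1) in \<open>auto intro: epowr_mono\<close>)
qed (use assms(1) in auto)

lemma Lp_norm_cmult:
  assumes "0 < p" "0 \<le> c"
  shows "Lp_norm p (\<lambda>x. ennreal c * a x) = ennreal c * Lp_norm p a"
proof (cases "c = 0")
  case False
  then show ?thesis
    using assms by (simp add: Lp_norm_def epowr_mult epowr_ennreal nn_integral_cmult_pos powr_powr)
qed (simp add: Lp_norm_def)

lemma Lp_norm_add_le:
  assumes "0 < p" "b \<in> borel_measurable lebesgue"
  shows "Lp_norm p (\<lambda>x. a x + b x) \<le> ennreal (2 * 2 powr (1 / p)) * (Lp_norm p a + Lp_norm p b)"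
  unfolding Lp_norm_def
  using epowr_nn_integral_add_le[OF assms(1) _ assms(2), of "\<lambda>_. 1" a] by simp

lemma Lp_norm_dilate:
  fixes G :: "real^'n \<Rightarrow> ennreal"
  assumes "0 < p" "0 < l"
  shows "Lp_norm p (\<lambda>x. G (l *\<^sub>R x)) = ennreal (l powr (- real CARD('n) / p)) * Lp_norm p G"
proof -
  have eq: "(\<integral>\<^sup>+x. epowr (G x) p \<partial>lebesgue)
      = ennreal (l ^ CARD('n)) * (\<integral>\<^sup>+x. epowr (G (l *\<^sub>R x)) p \<partial>lebesgue)"
    using nn_integral_lebesgue_affine[of l "\<lambda>x. epowr (G x) p" 0] assms by simp
  have "l powr (- real CARD('n) / p) * (l ^ CARD('n)) powr (1 / p) = 1"
    using assms by (simp add: powr_realpow[symmetric] powr_powr powr_add[symmetric])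
  then show ?thesis
    unfolding Lp_norm_def eq using assms
    by (simp add: epowr_mult epowr_ennreal mult.assoc[symmetric] ennreal_mult[symmetric])
qed

section \<open>The quasi-norm in the scale variable\<close>

text \<open>The inner quasi-norm of the Triebel-Lizorkin norm as a functional of the function \<open>D\<close> of the
  scale alone, with the upper end \<open>L\<close> of the range of scales variable: a dilation by \<open>l\<close> moves
  this end from 1 to \<open>l\<close>.\<close>

definition scale_norm :: "real \<Rightarrow> ennreal \<Rightarrow> real \<Rightarrow> (real \<Rightarrow> ennreal) \<Rightarrow> ennreal" where
  "scale_norm s q L D =
     (if q = \<infinity> then (SUP t\<in>{0<..L}. ennreal (t powr (- s)) * D t)
      else epowr
        (\<integral>\<^sup>+t\<in>{0<..L}. ennreal (t powr (- (s * enn2real q))) *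
           epowr (D t) (enn2real q) * ennreal (1 / t) \<partial>lebesgue)
        (1 / enn2real q))"

lemma TL_inner_eq_scale_norm: "TL_inner r s p q f x = scale_norm s q 1 (\<lambda>t. ball_mean r p t f x)"
  by (simp add: TL_inner_def scale_norm_def)

lemma enn2real_exponent_pos: "0 < q \<Longrightarrow> q \<noteq> \<infinity> \<Longrightarrow> 0 < enn2real q"
  by (simp add: enn2real_positive_iff less_top)

lemma scale_norm_mono:
  assumes "L \<le> L'" "\<And>t. 0 < t \<Longrightarrow> t \<le> L \<Longrightarrow> D t \<le> E t"
  shows "scale_norm s q L D \<le> scale_norm s q L' E"
proof (cases "q = \<infinity>")
  case True
  show ?thesis
    unfolding scale_norm_def if_P[OF True]
  proof (rule SUP_mono)
    fix t assume "t \<in> {0<..L}"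
    then show "\<exists>u\<in>{0<..L'}. ennreal (t powr - s) * D t \<le> ennreal (u powr - s) * E u"
      using assms by (intro bexI[of _ t] mult_left_mono) auto
  qed
next
  case False
  then show ?thesis
    using assms unfolding scale_norm_def if_not_P[OF False]
    by (intro epowr_mono nn_integral_mono)
      (auto simp: indicator_def intro!: mult_right_mono mult_left_mono epowr_mono)
qed

lemma scale_norm_cutoff_le:
  assumes "0 < q"
  shows "scale_norm s q L (\<lambda>t. if t \<le> l then D t else 0) \<le> scale_norm s q l D"
proof (cases "q = \<infinity>")
  case True
  show ?thesis
    unfolding scale_norm_def if_P[OF True]
  proof (rule SUP_least)
    fix t assume t: "t \<in> {0<..L}"
    show "ennreal (t powr - s) * (if t \<le> l then D t else 0) \<le> (SUP t\<in>{0<..l}. ennreal (t powr - s) * D t)"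
      using t by (cases "t \<le> l") (auto intro: SUP_upper)
  qed
next
  case False
  have "0 < enn2real q"
    using assms False by (rule enn2real_exponent_pos)
  then show ?thesis
    unfolding scale_norm_def if_not_P[OF False]
    by (intro epowr_mono nn_integral_mono) (auto simp: indicator_def)
qed

lemma scale_norm_dilate:
  assumes "0 < l" "0 < q"
  shows "scale_norm s q 1 (\<lambda>t. D (l * t)) = ennreal (l powr s) * scale_norm s q l D"
proof (cases "q = \<infinity>")
  case True
  have img: "{0<..l} = (\<lambda>t. l * t) ` {0<..1}"
  proof (intro equalityI subsetI)
    fix t assume "t \<in> {0<..l}"
    then show "t \<in> (\<lambda>t. l * t) ` {0<..1}"
      using assms(1) by (intro image_eqI[of _ _ "t / l"]) auto
  qed (use assms(1) in \<open>auto simp: mult_le_cancel_left1\<close>)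
  have "ennreal (l powr s) * (ennreal ((l * t) powr - s) * D (l * t)) = ennreal (t powr - s) * D (l * t)"
    if "t \<in> {0<..1}" for t
  proof -
    have "l powr s * (l * t) powr - s = t powr - s"
      using assms(1) that by (simp add: powr_mult powr_add[symmetric] mult.assoc[symmetric])
    then show ?thesis
      by (simp add: mult.assoc[symmetric] ennreal_mult[symmetric])
  qed
  then show ?thesis
    using True by (simp add: scale_norm_def img image_image SUP_mult_left_ennreal)
next
  case False
  define Q where "Q = enn2real q"
  have Q: "0 < Q"
    unfolding Q_def using assms(2) False by (rule enn2real_exponent_pos)
  let ?G = "\<lambda>t. ennreal (t powr (- (s * Q))) * epowr (D t) Q * ennreal (1 / t) * indicator {0<..l} t"
  let ?H = "\<lambda>t. ennreal (t powr (- (s * Q))) * epowr (D (l * t)) Q * ennreal (1 / t) * indicator {0<..1} t"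
  have G: "?G (l * t) = ennreal (l powr (- (s * Q) - 1)) * ?H t" for t
  proof (cases "t \<in> {0<..1}")
    case True
    have "(l * t) powr (- (s * Q)) * (1 / (l * t)) = l powr (- (s * Q) - 1) * (t powr (- (s * Q)) * (1 / t))"
      using assms(1) True by (simp add: powr_mult powr_diff)
    then have "ennreal ((l * t) powr (- (s * Q))) * ennreal (1 / (l * t))
        = ennreal (l powr (- (s * Q) - 1)) * (ennreal (t powr (- (s * Q))) * ennreal (1 / t))"
      using assms(1) True by (simp add: ennreal_mult[symmetric])
    moreover have "l * t \<in> {0<..l}"
      using True assms(1) by (auto simp: mult_le_cancel_left1)
    ultimately show ?thesis
      using True by (simp add: mult_ac)
  next
    case False
    then have "l * t \<notin> {0<..l}"
      using assms(1) by (auto simp: zero_less_mult_iff mult_le_cancel_left1)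
    with False show ?thesis by simp
  qed
  have "(\<integral>\<^sup>+t. ?G t \<partial>lebesgue) = ennreal l * (\<integral>\<^sup>+t. ?G (l * t) \<partial>lebesgue)"
    using nn_integral_lebesgue_affine[of l ?G 0] assms(1) by simp
  also have "\<dots> = ennreal l * (ennreal (l powr (- (s * Q) - 1)) * (\<integral>\<^sup>+t. ?H t \<partial>lebesgue))"
    unfolding G using assms(1) by (subst nn_integral_cmult_pos) auto
  also have "\<dots> = ennreal (l powr (- (s * Q))) * (\<integral>\<^sup>+t. ?H t \<partial>lebesgue)"
    using assms(1) by (simp add: mult.assoc[symmetric] ennreal_mult[symmetric] powr_diff)
  finally have eq: "(\<integral>\<^sup>+t. ?G t \<partial>lebesgue) = ennreal (l powr (- (s * Q))) * (\<integral>\<^sup>+t. ?H t \<partial>lebesgue)" .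
  have "l powr s * (l powr (- (s * Q))) powr (1 / Q) = 1"
    using Q assms(1) by (simp add: powr_powr powr_add[symmetric])
  then have "ennreal (l powr s) * epowr (\<integral>\<^sup>+t. ?G t \<partial>lebesgue) (1 / Q) = epowr (\<integral>\<^sup>+t. ?H t \<partial>lebesgue) (1 / Q)"
    unfolding eq by (simp add: epowr_mult epowr_ennreal mult.assoc[symmetric] ennreal_mult[symmetric])
  then show ?thesis
    using False by (simp add: scale_norm_def Q_def)
qed

lemma scale_norm_add_le:
  assumes "0 < q"
  obtains K where "0 < K" "\<And>L D E. E \<in> borel_measurable lebesgue \<Longrightarrow>
    scale_norm s q L (\<lambda>t. D t + E t) \<le> ennreal K * (scale_norm s q L D + scale_norm s q L E)"
proof (cases "q = \<infinity>")
  case True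
  have "scale_norm s q L (\<lambda>t. D t + E t) \<le> ennreal 1 * (scale_norm s q L D + scale_norm s q L E)" for L D E
    unfolding scale_norm_def if_P[OF True]
    by (auto simp: distrib_left intro!: SUP_least add_mono SUP_upper)
  then show ?thesis
    by (intro that[of 1]) auto
next
  case False
  define Q where "Q = enn2real q"
  have Q: "0 < Q"
    unfolding Q_def using assms False by (rule enn2real_exponent_pos)
  have [measurable]: "{0<..L} \<in> sets lebesgue" for L :: real
    by simp
  have "scale_norm s q L (\<lambda>t. D t + E t)
      \<le> ennreal (2 * 2 powr (1 / Q)) * (scale_norm s q L D + scale_norm s q L E)"
    if "E \<in> borel_measurable lebesgue" for L D E
  proof -
    let ?w = "\<lambda>t. ennreal (t powr (- (s * Q))) * ennreal (1 / t) * indicator {0<..L} t"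
    have "?w \<in> borel_measurable lborel"
      by measurable
    then have w: "?w \<in> borel_measurable lebesgue"
      by (rule measurable_completion)
    have "scale_norm s q L D' = epowr (\<integral>\<^sup>+t. ?w t * epowr (D' t) Q \<partial>lebesgue) (1 / Q)" for D'
      using False by (simp add: scale_norm_def Q_def mult_ac)
    then show ?thesis
      using epowr_nn_integral_add_le[OF Q w that, of D] by simp
  qed
  then show ?thesis
    by (intro that[of "2 * 2 powr (1 / Q)"]) auto
qed

text \<open>Since \<open>s > 0\<close>, the contribution of a function of size \<open>M t powr - \<beta>\<close> living on the scales
  \<open>t \<ge> \<rho>\<close> is, up to a constant, that of the smallest of these scales.\<close>

lemma scale_norm_tail:
  assumes "0 < q" "0 < s" "0 \<le> \<beta>"
  obtains K where "0 < K" "\<And>L M \<rho>. 0 \<le> M \<Longrightarrow> 0 < \<rho> \<Longrightarrow>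
    scale_norm s q L (\<lambda>t. if \<rho> \<le> t then ennreal (M * t powr - \<beta>) else 0)
      \<le> ennreal (K * (M * \<rho> powr (- s - \<beta>)))"
proof (cases "q = \<infinity>")
  case True
  have "scale_norm s q L (\<lambda>t. if \<rho> \<le> t then ennreal (M * t powr - \<beta>) else 0)
      \<le> ennreal (1 * (M * \<rho> powr (- s - \<beta>)))" if "0 \<le> M" "0 < \<rho>" for L M \<rho>
    unfolding scale_norm_def if_P[OF True]
  proof (rule SUP_least)
    fix t assume t: "t \<in> {0<..L}"
    have "t powr - s * (M * t powr - \<beta>) \<le> M * \<rho> powr (- s - \<beta>)" if "\<rho> \<le> t"
    proof -
      have "t powr - s * (M * t powr - \<beta>) = M * t powr (- s - \<beta>)"
        using t by (simp add: powr_add[symmetric])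
      also have "\<dots> \<le> M * \<rho> powr (- s - \<beta>)"
        using assms \<open>0 \<le> M\<close> \<open>0 < \<rho>\<close> that by (intro mult_left_mono powr_mono2') auto
      finally show ?thesis .
    qed
    then show "ennreal (t powr - s) * (if \<rho> \<le> t then ennreal (M * t powr - \<beta>) else 0)
        \<le> ennreal (1 * (M * \<rho> powr (- s - \<beta>)))"
      using \<open>0 \<le> M\<close> by (auto simp: ennreal_mult[symmetric] intro!: ennreal_leI)
  qed
  then show ?thesis
    by (intro that[of 1]) auto
next
  case False
  define Q where "Q = enn2real q"
  have Q: "0 < Q"
    unfolding Q_def using assms(1) False by (rule enn2real_exponent_pos)
  define b where "b = (s + \<beta>) * Q"
  have b: "0 < b"
    using assms Q by (simp add: b_def add_pos_nonneg)
  have "scale_norm s q L (\<lambda>t. if \<rho> \<le> t then ennreal (M * t powr - \<beta>) else 0)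
      \<le> ennreal ((1 / b) powr (1 / Q) * (M * \<rho> powr (- s - \<beta>)))" if "0 \<le> M" "0 < \<rho>" for L M \<rho>
  proof -
    have "(\<integral>\<^sup>+t\<in>{0<..L}. ennreal (t powr (- (s * Q))) *
           epowr (if \<rho> \<le> t then ennreal (M * t powr - \<beta>) else 0) Q * ennreal (1 / t) \<partial>lebesgue)
        \<le> (\<integral>\<^sup>+t. ennreal (M powr Q) * (ennreal (t powr (- b - 1)) * indicator {\<rho>..} t) \<partial>lebesgue)"
    proof (rule nn_integral_mono)
      fix t :: real
      have "t powr (- (s * Q)) * (M * t powr - \<beta>) powr Q * (1 / t) = M powr Q * t powr (- b - 1)" if "0 < t"
      proof -
        have "t powr (- (s * Q)) * (M * t powr - \<beta>) powr Q * (1 / t)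
            = M powr Q * (t powr (- (s * Q)) * t powr (- \<beta> * Q) / t powr 1)"
          using that \<open>0 \<le> M\<close> by (simp add: powr_mult powr_powr)
        also have "\<dots> = M powr Q * t powr (- b - 1)"
          unfolding powr_add[symmetric] powr_diff[symmetric] b_def by (simp add: algebra_simps)
        finally show ?thesis .
      qed
      then show "ennreal (t powr (- (s * Q))) * epowr (if \<rho> \<le> t then ennreal (M * t powr - \<beta>) else 0) Q *
          ennreal (1 / t) * indicator {0<..L} t
        \<le> ennreal (M powr Q) * (ennreal (t powr (- b - 1)) * indicator {\<rho>..} t)"
        using \<open>0 \<le> M\<close> by (auto simp: indicator_def epowr_ennreal ennreal_mult[symmetric])
    qed
    also have "\<dots> = ennreal (M powr Q) * ennreal (\<rho> powr - b / b)"
      using \<open>0 < \<rho>\<close> b by (subst nn_integral_cmult) (auto simp: nn_integral_powr_tail intro!: measurable_completion)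
    also have "\<dots> = ennreal (M powr Q * (\<rho> powr - b / b))"
      using b by (simp add: ennreal_mult[symmetric])
    finally have "scale_norm s q L (\<lambda>t. if \<rho> \<le> t then ennreal (M * t powr - \<beta>) else 0)
        \<le> epowr (ennreal (M powr Q * (\<rho> powr - b / b))) (1 / Q)"
      using False Q by (simp add: scale_norm_def Q_def[symmetric] epowr_mono)
    also have "\<dots> = ennreal ((M powr Q * (\<rho> powr - b * (1 / b))) powr (1 / Q))"
      using b by (simp add: epowr_ennreal)
    also have "(M powr Q * (\<rho> powr - b * (1 / b))) powr (1 / Q) = M * (\<rho> powr (- s - \<beta>) * (1 / b) powr (1 / Q))"
    proof -
      have "- b * (1 / Q) = - s - \<beta>"
        using Q by (simp add: b_def)
      then show ?thesis
        using Q b \<open>0 \<le> M\<close> unfolding powr_mult powr_powr by simp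
    qed
    finally show ?thesis
      by (simp add: mult_ac)
  qed
  then show ?thesis
    using b by (intro that[of "(1 / b) powr (1 / Q)"]) auto
qed

text \<open>The scales between \<open>3 l\<close> and \<open>4 l\<close> have logarithmic measure independent of \<open>l\<close>, so they alone
  give the factor \<open>l powr - s\<close>; for \<open>q = \<infinity>\<close> the single scale \<open>4 l\<close> does.\<close>

lemma scale_norm_lower:
  assumes "0 < q" "0 < s"
  obtains k where "0 < k" "\<And>D l m. 0 < l \<Longrightarrow> 4 * l \<le> 1 \<Longrightarrow> (\<And>t. 3 * l \<le> t \<Longrightarrow> t \<le> 4 * l \<Longrightarrow> m \<le> D t) \<Longrightarrow>
    ennreal (k * l powr - s) * m \<le> scale_norm s q 1 D"
proof (cases "q = \<infinity>")
  case True
  have "ennreal (4 powr - s * l powr - s) * m \<le> scale_norm s q 1 D"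
    if "0 < l" "4 * l \<le> 1" "\<And>t. 3 * l \<le> t \<Longrightarrow> t \<le> 4 * l \<Longrightarrow> m \<le> D t" for D l m
  proof -
    have "ennreal (4 powr - s * l powr - s) * m \<le> ennreal ((4 * l) powr - s) * D (4 * l)"
      using that by (intro mult_mono) (auto simp: powr_mult)
    also have "\<dots> \<le> scale_norm s q 1 D"
      unfolding scale_norm_def if_P[OF True] using that by (intro SUP_upper) auto
    finally show ?thesis .
  qed
  then show ?thesis
    by (intro that[of "4 powr - s"]) auto
next
  case False
  define Q where "Q = enn2real q"
  have Q: "0 < Q"
    unfolding Q_def using assms(1) False by (rule enn2real_exponent_pos)
  define \<kappa> where "\<kappa> = 4 powr (- (s * Q)) / 4"
  have \<kappa>: "0 < \<kappa>" by (simp add: \<kappa>_def)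
  have "ennreal (\<kappa> powr (1 / Q) * l powr - s) * m \<le> scale_norm s q 1 D"
    if l: "0 < l" "4 * l \<le> 1" and m: "\<And>t. 3 * l \<le> t \<Longrightarrow> t \<le> 4 * l \<Longrightarrow> m \<le> D t" for D l m
  proof -
    have "ennreal (\<kappa> * l powr (- (s * Q))) * epowr m Q
        = (\<integral>\<^sup>+t. ennreal (\<kappa> * l powr (- (s * Q)) / l) * epowr m Q * indicator {3 * l..4 * l} t \<partial>lebesgue)"
    proof -
      have "ennreal (\<kappa> * l powr (- (s * Q)) / l) * ennreal l = ennreal (\<kappa> * l powr (- (s * Q)))"
        using l \<kappa> by (simp add: ennreal_mult[symmetric])
      moreover have "emeasure lebesgue {3 * l..4 * l} = ennreal l"
        using l by simp
      ultimately show ?thesis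
        by (subst nn_integral_cmult_indicator) (simp, metis mult.assoc mult.commute)
    qed
    also have "\<dots> \<le> (\<integral>\<^sup>+t\<in>{0<..1}. ennreal (t powr (- (s * Q))) * epowr (D t) Q * ennreal (1 / t) \<partial>lebesgue)"
    proof (rule nn_integral_mono)
      fix t :: real
      have "ennreal (\<kappa> * l powr (- (s * Q)) / l) * epowr m Q
          \<le> ennreal (t powr (- (s * Q))) * epowr (D t) Q * ennreal (1 / t)" if t: "3 * l \<le> t" "t \<le> 4 * l"
      proof -
        have "(4 * l) powr (- (s * Q)) \<le> t powr (- (s * Q))"
          using t l assms(2) Q by (intro powr_mono2') auto
        moreover have "(4 * l) powr (- (s * Q)) = 4 * \<kappa> * l powr (- (s * Q))"
          using l by (simp add: \<kappa>_def powr_mult)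
        ultimately have "4 * \<kappa> * l powr (- (s * Q)) * (1 / (4 * l)) \<le> t powr (- (s * Q)) * (1 / t)"
          using t l by (intro mult_mono divide_left_mono) auto
        then have "\<kappa> * l powr (- (s * Q)) / l \<le> t powr (- (s * Q)) * (1 / t)"
          by simp
        then have "ennreal (\<kappa> * l powr (- (s * Q)) / l) \<le> ennreal (t powr (- (s * Q))) * ennreal (1 / t)"
          using t l by (simp add: ennreal_mult[symmetric] ennreal_leI)
        then have "ennreal (\<kappa> * l powr (- (s * Q)) / l) * epowr m Q
            \<le> (ennreal (t powr (- (s * Q))) * ennreal (1 / t)) * epowr (D t) Q"
          using m t Q by (intro mult_mono epowr_mono) auto
        then show ?thesis by (simp add: mult_ac)
      qed
      then show "ennreal (\<kappa> * l powr (- (s * Q)) / l) * epowr m Q * indicator {3 * l..4 * l} t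
          \<le> ennreal (t powr (- (s * Q))) * epowr (D t) Q * ennreal (1 / t) * indicator {0<..1} t"
        using l by (auto simp: indicator_def)
    qed
    finally have "epowr (ennreal (\<kappa> * l powr (- (s * Q))) * epowr m Q) (1 / Q) \<le> scale_norm s q 1 D"
      using False Q by (simp add: scale_norm_def Q_def[symmetric] epowr_mono)
    moreover have "epowr (ennreal (\<kappa> * l powr (- (s * Q))) * epowr m Q) (1 / Q)
        = ennreal (\<kappa> powr (1 / Q) * l powr - s) * m"
      using Q \<kappa> by (simp add: epowr_mult epowr_epowr epowr_ennreal powr_mult powr_powr)
    ultimately show ?thesis by simp
  qed
  then show ?thesis
    using \<kappa> by (intro that[of "\<kappa> powr (1 / Q)"]) auto
qed

section \<open>Ball means of functions with small support\<close>

lemma ball_mean_dilate: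
  fixes f :: "real^'n \<Rightarrow> complex"
  assumes "0 < l" "0 < t"
  shows "ball_mean r p t (\<lambda>x. f (l *\<^sub>R x)) x = ball_mean r p (l * t) f (l *\<^sub>R x)"
proof -
  let ?G = "\<lambda>h. ennreal (norm (iter_diff r h f (l *\<^sub>R x)) powr p) * indicator (cball 0 (l * t)) h"
  let ?I = "\<integral>\<^sup>+h. ennreal (norm (iter_diff r (l *\<^sub>R h) f (l *\<^sub>R x)) powr p) * indicator (cball 0 t) h \<partial>lebesgue"
  have "(\<integral>\<^sup>+h. ?G h \<partial>lebesgue) = ennreal (l ^ CARD('n)) * (\<integral>\<^sup>+h. ?G (l *\<^sub>R h) \<partial>lebesgue)"
    using nn_integral_lebesgue_affine[of l ?G 0] assms by simp
  also have "(\<integral>\<^sup>+h. ?G (l *\<^sub>R h) \<partial>lebesgue) = ?I"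
    using assms by (intro nn_integral_cong) (simp add: indicator_def)
  finally have "ennreal ((l * t) powr - real CARD('n)) * (\<integral>\<^sup>+h. ?G h \<partial>lebesgue)
      = ennreal ((l * t) powr - real CARD('n) * l ^ CARD('n)) * ?I"
    using assms by (simp add: ennreal_mult mult.assoc)
  also have "(l * t) powr - real CARD('n) * l ^ CARD('n) = t powr - real CARD('n)"
    using assms by (simp add: powr_mult powr_minus powr_realpow)
  finally show ?thesis
    by (simp add: ball_mean_def iter_diff_dilate)
qed

text \<open>For \<open>2 l \<le> norm h\<close> all translates \<open>x + j h\<close> of a point of the ball of radius \<open>l\<close> lie outside this
  ball, so the difference has the size of \<open>f x\<close>. Among these \<open>h\<close> is a ball of radius \<open>l / 2\<close>, which
  occupies a fixed fraction of the ball of radius \<open>t\<close> when \<open>3 l \<le> t \<le> 4 l\<close>.\<close>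

lemma ball_mean_lower:
  assumes "0 < p"
  obtains k where "0 < k" "\<And>(f :: real^'n \<Rightarrow> complex) l t x.
    (AE y in lebesgue. y \<notin> ball 0 l \<longrightarrow> f y = 0) \<Longrightarrow> 0 < l \<Longrightarrow> 3 * l \<le> t \<Longrightarrow> t \<le> 4 * l \<Longrightarrow> x \<in> ball 0 l \<Longrightarrow>
    ennreal (k * norm (f x)) \<le> ball_mean r p t f x"
proof -
  define V where "V = unit_ball_vol (real CARD('n))"
  have V: "0 < V" by (simp add: V_def)
  define \<kappa> where "\<kappa> = V * (1 / 8) ^ CARD('n)"
  have \<kappa>: "0 < \<kappa>" using V by (simp add: \<kappa>_def)
  have "ennreal (\<kappa> powr (1 / p) * norm (f x)) \<le> ball_mean r p t f x"
    if supp: "AE y in lebesgue. y \<notin> ball 0 l \<longrightarrow> f y = 0" and l: "0 < l" and t: "3 * l \<le> t" "t \<le> 4 * l"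
      and x: "x \<in> ball 0 l" for f :: "real^'n \<Rightarrow> complex" and l t x
  proof -
    \<comment> \<open>A ball of radius \<open>l / 2\<close> around a point of norm \<open>5 / 2 * l\<close> fits between the spheres of radius \<open>2 l\<close> and \<open>3 l\<close>.\<close>
    obtain e :: "real^'n" where e: "norm e = 5 / 2 * l"
      using vector_choose_size[of "5 / 2 * l"] l by auto
    let ?B = "ball e (l / 2)"
    have B: "2 * l \<le> norm h \<and> norm h \<le> t" if "h \<in> ?B" for h
      using that e t norm_triangle_ineq2[of e h] norm_triangle_ineq2[of h e]
      by (auto simp: dist_norm norm_minus_commute)
    have "AE h in lebesgue. \<forall>j\<in>{1..r}. x + real j *\<^sub>R h \<notin> ball 0 l \<longrightarrow> f (x + real j *\<^sub>R h) = 0"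
      using supp by (intro AE_finite_allI AE_lebesgue_affine[where P = "\<lambda>y. y \<notin> ball 0 l \<longrightarrow> f y = 0"]) auto
    then have ae: "AE h in lebesgue. ennreal (norm (f x) powr p) * indicator ?B h
        \<le> ennreal (norm (iter_diff r h f x) powr p) * indicator (cball 0 t) h"
    proof eventually_elim
      case (elim h)
      have "norm (iter_diff r h f x) = norm (f x)" if h: "h \<in> ?B"
      proof (rule norm_iter_diff_eq)
        fix j :: nat assume j: "1 \<le> j" "j \<le> r"
        have "2 * l \<le> 1 * norm h" using B[OF h] by simp
        also have "\<dots> \<le> real j * norm h" using j by (intro mult_right_mono) auto
        finally have "2 * l \<le> norm (real j *\<^sub>R h)" by simp
        then have "x + real j *\<^sub>R h \<notin> ball 0 l"
          using x norm_triangle_ineq2[of "real j *\<^sub>R h" "- x"] by (simp add: add.commute)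
        then show "f (x + real j *\<^sub>R h) = 0"
          using elim j by auto
      qed
      then show ?case
        using B[of h] by (auto simp: indicator_def)
    qed
    have "ennreal (\<kappa> * norm (f x) powr p)
        \<le> ennreal (t powr - real CARD('n) * (V * (l / 2) ^ CARD('n)) * norm (f x) powr p)"
    proof (intro ennreal_leI mult_right_mono)
      have "(4 * l) powr - real CARD('n) = (1 / (4 * l)) ^ CARD('n)"
        using l by (simp add: powr_minus powr_realpow power_one_over inverse_eq_divide)
      moreover have "1 / (4 * l) * (l / 2) = 1 / 8"
        using l by simp
      ultimately have "(1 / 8) ^ CARD('n) = (4 * l) powr - real CARD('n) * (l / 2) ^ CARD('n)"
        by (simp only: power_mult_distrib[symmetric])
      also have "\<dots> \<le> t powr - real CARD('n) * (l / 2) ^ CARD('n)"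
        using l t by (intro mult_right_mono powr_mono2') auto
      finally show "\<kappa> \<le> t powr - real CARD('n) * (V * (l / 2) ^ CARD('n))"
        using V by (simp add: \<kappa>_def)
    qed simp
    also have "\<dots> = ennreal (t powr - real CARD('n)) *
        (\<integral>\<^sup>+h. ennreal (norm (f x) powr p) * indicator ?B h \<partial>lebesgue)"
      using l V by (simp add: nn_integral_cmult_indicator emeasure_ball emeasure_cball V_def[symmetric]
          ennreal_mult[symmetric] mult_ac)
    also have "\<dots> \<le> ennreal (t powr - real CARD('n)) *
        (\<integral>\<^sup>+h\<in>cball 0 t. ennreal (norm (iter_diff r h f x) powr p) \<partial>lebesgue)"
      using ae by (intro mult_left_mono nn_integral_mono_AE) auto
    finally have "epowr (ennreal (\<kappa> * norm (f x) powr p)) (1 / p) \<le> ball_mean r p t f x"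
      unfolding ball_mean_def using assms by (intro epowr_mono) auto
    moreover have "epowr (ennreal (\<kappa> * norm (f x) powr p)) (1 / p) = ennreal (\<kappa> powr (1 / p) * norm (f x))"
      using assms \<kappa> by (simp add: epowr_ennreal powr_mult powr_powr)
    ultimately show ?thesis by simp
  qed
  then show ?thesis
    using \<kappa> by (intro that[of "\<kappa> powr (1 / p)"]) auto
qed

text \<open>The difference is bounded by \<open>2 ^ r\<close> times the largest of the values involved, and the \<open>p\<close>-th
  power of the largest is at most the sum of the \<open>p\<close>-th powers. This treats \<open>p < 1\<close> and
  \<open>p \<ge> 1\<close> alike.\<close>

lemma norm_iter_diff_powr_le:
  assumes "0 < p"
  shows "norm (iter_diff r h f x) powr p \<le> 2 powr (real r * p) * (\<Sum>j\<le>r. norm (f (x + real j *\<^sub>R h)) powr p)"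
proof -
  let ?S = "\<Sum>j\<le>r. norm (f (x + real j *\<^sub>R h)) powr p"
  have "norm (iter_diff r h f x) \<le> 2 ^ r * ?S powr (1 / p)"
  proof (rule norm_iter_diff_le)
    fix j assume "j \<le> r"
    then have "norm (f (x + real j *\<^sub>R h)) powr p \<le> ?S"
      by (intro member_le_sum) auto
    then have "(norm (f (x + real j *\<^sub>R h)) powr p) powr (1 / p) \<le> ?S powr (1 / p)"
      using assms by (intro powr_mono2) auto
    then show "norm (f (x + real j *\<^sub>R h)) \<le> ?S powr (1 / p)"
      using assms by (simp add: powr_powr)
  qed
  then have "norm (iter_diff r h f x) powr p \<le> (2 ^ r * ?S powr (1 / p)) powr p"
    using assms by (intro powr_mono2) auto
  also have "\<dots> = 2 powr (real r * p) * ?S"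
    using assms by (simp add: powr_mult powr_powr powr_realpow[symmetric] sum_nonneg)
  finally show ?thesis .
qed

text \<open>Substituting \<open>y = x + j h\<close> gives the integral of \<open>f\<close> over a ball of radius at most \<open>r t\<close> around \<open>x\<close>.
  This ball misses the support, which lies in the ball of radius \<open>l \<le> t\<close> around 0, as soon as
  \<open>norm x\<close> exceeds \<open>(r + 1) t\<close>.\<close>

lemma nn_integral_translates_le:
  fixes f :: "real^'n \<Rightarrow> complex"
  assumes supp: "AE y in lebesgue. y \<notin> ball 0 l \<longrightarrow> f y = 0" and "l \<le> t" and j: "1 \<le> j" "j \<le> r"
  shows "(\<integral>\<^sup>+h\<in>cball 0 t. ennreal (norm (f (x + real j *\<^sub>R h)) powr p) \<partial>lebesgue)
    \<le> (if norm x \<le> real (r + 1) * t then \<integral>\<^sup>+y. ennreal (norm (f y) powr p) \<partial>lebesgue else 0)"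
proof (cases "norm x \<le> real (r + 1) * t")
  case True
  have "(\<integral>\<^sup>+h\<in>cball 0 t. ennreal (norm (f (x + real j *\<^sub>R h)) powr p) \<partial>lebesgue)
      \<le> 1 * (\<integral>\<^sup>+h. ennreal (norm (f (x + real j *\<^sub>R h)) powr p) \<partial>lebesgue)"
    by (auto simp: indicator_def intro!: nn_integral_mono)
  also have "\<dots> \<le> ennreal (\<bar>real j\<bar> ^ DIM(real^'n)) * (\<integral>\<^sup>+h. ennreal (norm (f (x + real j *\<^sub>R h)) powr p) \<partial>lebesgue)"
    using j by (intro mult_right_mono) (simp_all add: one_le_power)
  also have "\<dots> = (\<integral>\<^sup>+y. ennreal (norm (f y) powr p) \<partial>lebesgue)"
    using nn_integral_lebesgue_affine[of "real j" "\<lambda>y. ennreal (norm (f y) powr p)" x] j by simp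
  finally show ?thesis using True by simp
next
  case False
  have "AE h in lebesgue. x + real j *\<^sub>R h \<notin> ball 0 l \<longrightarrow> f (x + real j *\<^sub>R h) = 0"
    using supp j by (intro AE_lebesgue_affine[where P = "\<lambda>y. y \<notin> ball 0 l \<longrightarrow> f y = 0"]) auto
  then have "AE h in lebesgue. ennreal (norm (f (x + real j *\<^sub>R h)) powr p) * indicator (cball 0 t) h \<le> 0"
  proof eventually_elim
    case (elim h)
    show ?case
    proof (cases "h \<in> cball 0 t")
      case True
      have "real j * norm h \<le> real r * t"
        using True j by (intro mult_mono) auto
      then have "t < norm (x + real j *\<^sub>R h)"
        using False norm_triangle_ineq2[of x "- (real j *\<^sub>R h)"] by (simp add: algebra_simps)
      then show ?thesis
        using elim \<open>l \<le> t\<close> by simp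
    qed simp
  qed
  then have "(\<integral>\<^sup>+h\<in>cball 0 t. ennreal (norm (f (x + real j *\<^sub>R h)) powr p) \<partial>lebesgue) \<le> (\<integral>\<^sup>+h. 0 \<partial>(lebesgue :: (real^'n) measure))"
    by (rule nn_integral_mono_AE)
  then show ?thesis using False by simp
qed

text \<open>Above the scale \<open>l\<close> of the support no cancellation in the differences is to be expected: the term \<open>j = 0\<close>
  contributes \<open>f x\<close>, and each translate the whole \<open>L\<^sub>p\<close>-norm of \<open>f\<close>, averaged over a ball
  whose volume is proportional to \<open>t ^ n\<close>.\<close>

lemma ball_mean_upper:
  assumes "0 < p"
  obtains K where "0 < K" "\<And>(f :: real^'n \<Rightarrow> complex) l t x.
    f \<in> borel_measurable lebesgue \<Longrightarrow> (AE y in lebesgue. y \<notin> ball 0 l \<longrightarrow> f y = 0) \<Longrightarrow> 0 < l \<Longrightarrow> l \<le> t \<Longrightarrow>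
    ball_mean r p t f x \<le> ennreal K * (ennreal (norm (f x)) +
      (if norm x \<le> real (r + 1) * t then ennreal (t powr (- real CARD('n) / p)) * Lp_norm p (\<lambda>y. ennreal (norm (f y))) else 0))"
proof -
  define V where "V = unit_ball_vol (real CARD('n))"
  have V: "0 < V" by (simp add: V_def)
  define C where "C = 2 powr (real r * p) * (V + real r)"
  have C: "0 < C" using V by (simp add: C_def add_pos_nonneg)
  have "ball_mean r p t f x \<le> ennreal (C powr (1 / p) * 2 powr (1 / p)) * (ennreal (norm (f x)) +
      (if norm x \<le> real (r + 1) * t then ennreal (t powr (- real CARD('n) / p)) * Lp_norm p (\<lambda>y. ennreal (norm (f y))) else 0))"
    if f[measurable]: "f \<in> borel_measurable lebesgue"
      and supp: "AE y in lebesgue. y \<notin> ball 0 l \<longrightarrow> f y = 0" and l: "0 < l" "l \<le> t"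
    for f :: "real^'n \<Rightarrow> complex" and l t x
  proof -
    define I where "I = (\<integral>\<^sup>+y. ennreal (norm (f y) powr p) \<partial>lebesgue)"
    define J where "J = (if norm x \<le> real (r + 1) * t then I else 0)"
    define a where "a = ennreal (norm (f x) powr p)"
    let ?g = "\<lambda>j h. ennreal (norm (f (x + real j *\<^sub>R h)) powr p) * indicator (cball 0 t) h"
    have meas: "?g j \<in> borel_measurable lebesgue" for j
    proof -
      have [measurable]: "cball 0 t \<in> sets (lebesgue :: (real^'n) measure)"
        by simp
      show ?thesis
      proof (cases "j = 0")
        case True
        then have "?g j = (\<lambda>h. ennreal (norm (f x) powr p) * indicator (cball 0 t) h)"
          by simp
        moreover have "(\<lambda>h. ennreal (norm (f x) powr p) * indicator (cball 0 t) h) \<in> borel_measurable lebesgue"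
          by (intro borel_measurable_times_ennreal borel_measurable_const borel_measurable_indicator) simp
        ultimately show ?thesis by (simp only:)
      next
        case False
        have [measurable]: "(\<lambda>h. x + real j *\<^sub>R h) \<in> lebesgue \<rightarrow>\<^sub>M lebesgue"
          using False by (intro lebesgue_measurable_affine) auto
        show ?thesis by measurable
      qed
    qed
    have "(\<integral>\<^sup>+h\<in>cball 0 t. ennreal (norm (iter_diff r h f x) powr p) \<partial>lebesgue)
        \<le> (\<integral>\<^sup>+h. ennreal (2 powr (real r * p)) * (\<Sum>j\<le>r. ?g j h) \<partial>lebesgue)"
    proof (rule nn_integral_mono)
      fix h :: "real^'n"
      have "ennreal (norm (iter_diff r h f x) powr p)
          \<le> ennreal (2 powr (real r * p)) * (\<Sum>j\<le>r. ennreal (norm (f (x + real j *\<^sub>R h)) powr p))"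
      proof -
        have "ennreal (norm (iter_diff r h f x) powr p)
            \<le> ennreal (2 powr (real r * p) * (\<Sum>j\<le>r. norm (f (x + real j *\<^sub>R h)) powr p))"
          by (rule ennreal_leI) (rule norm_iter_diff_powr_le[OF assms])
        then show ?thesis
          by (simp only: ennreal_mult' powr_ge_zero sum_ennreal)
      qed
      then show "ennreal (norm (iter_diff r h f x) powr p) * indicator (cball 0 t) h
          \<le> ennreal (2 powr (real r * p)) * (\<Sum>j\<le>r. ?g j h)"
        by (cases "h \<in> cball 0 t") simp_all
    qed
    also have "\<dots> = ennreal (2 powr (real r * p)) * (\<Sum>j\<le>r. \<integral>\<^sup>+h. ?g j h \<partial>lebesgue)"
      by (subst nn_integral_cmult_pos, simp, subst nn_integral_sum[OF meas], rule refl)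
    also have "(\<Sum>j\<le>r. \<integral>\<^sup>+h. ?g j h \<partial>lebesgue) = (\<integral>\<^sup>+h. ?g 0 h \<partial>lebesgue) + (\<Sum>j\<in>{1..r}. \<integral>\<^sup>+h. ?g j h \<partial>lebesgue)"
      by (simp add: atMost_atLeast0 sum.atLeast_Suc_atMost)
    also have "\<dots> \<le> ennreal (V * t ^ CARD('n)) * a + ennreal (real r) * J"
    proof (rule add_mono)
      show "(\<integral>\<^sup>+h. ?g 0 h \<partial>lebesgue) \<le> ennreal (V * t ^ CARD('n)) * a"
        using l by (simp add: nn_integral_cmult_indicator emeasure_cball V_def a_def) (simp add: mult.commute)
      have "(\<Sum>j\<in>{1..r}. \<integral>\<^sup>+h. ?g j h \<partial>lebesgue) \<le> of_nat (card {1..r}) * J"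
        unfolding J_def I_def using l by (intro sum_bounded_above nn_integral_translates_le[OF supp]) auto
      then show "(\<Sum>j\<in>{1..r}. \<integral>\<^sup>+h. ?g j h \<partial>lebesgue) \<le> ennreal (real r) * J"
        by (simp add: ennreal_of_nat_eq_real_of_nat)
    qed
    finally have "ennreal (t powr - real CARD('n)) * (\<integral>\<^sup>+h\<in>cball 0 t. ennreal (norm (iter_diff r h f x) powr p) \<partial>lebesgue)
        \<le> ennreal (t powr - real CARD('n)) * (ennreal (2 powr (real r * p)) * (ennreal (V * t ^ CARD('n)) * a + ennreal (real r) * J))"
      by (simp add: mult_left_mono)
    also have "\<dots> = ennreal (2 powr (real r * p)) * ((ennreal (t powr - real CARD('n)) * ennreal (V * t ^ CARD('n))) * a
        + ennreal (real r) * (ennreal (t powr - real CARD('n)) * J))"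
      by (simp only: distrib_left mult_ac)
    also have "\<dots> = ennreal (2 powr (real r * p)) * (ennreal V * a + ennreal (real r) * (ennreal (t powr - real CARD('n)) * J))"
    proof -
      have "ennreal (t powr - real CARD('n)) * ennreal (V * t ^ CARD('n)) = ennreal V"
        using l V by (simp add: ennreal_mult[symmetric] powr_minus powr_realpow)
      then show ?thesis by simp
    qed
    also have "\<dots> \<le> ennreal (2 powr (real r * p)) * (ennreal (V + real r) * a + ennreal (V + real r) * (ennreal (t powr - real CARD('n)) * J))"
      using V by (intro mult_left_mono add_mono mult_right_mono ennreal_leI) auto
    also have "\<dots> = ennreal C * (a + ennreal (t powr - real CARD('n)) * J)"
    proof -
      have "ennreal C = ennreal (2 powr (real r * p)) * ennreal (V + real r)"
        using V by (simp add: C_def ennreal_mult)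
      then show ?thesis
        by (simp only: distrib_left mult_ac)
    qed
    finally have "ball_mean r p t f x \<le> epowr (ennreal C * (a + ennreal (t powr - real CARD('n)) * J)) (1 / p)"
      unfolding ball_mean_def using assms by (intro epowr_mono) auto
    also have "\<dots> \<le> ennreal (C powr (1 / p)) * (ennreal (2 powr (1 / p)) * (epowr a (1 / p) + epowr (ennreal (t powr - real CARD('n)) * J) (1 / p)))"
      unfolding epowr_mult[of "ennreal C"] using C assms
      by (subst epowr_ennreal) (auto intro!: mult_left_mono epowr_add_le)
    also have "epowr a (1 / p) = ennreal (norm (f x))"
      using assms by (simp add: a_def epowr_ennreal powr_powr)
    also have "epowr (ennreal (t powr - real CARD('n)) * J) (1 / p)
        = (if norm x \<le> real (r + 1) * t then ennreal (t powr (- real CARD('n) / p)) * Lp_norm p (\<lambda>y. ennreal (norm (f y))) else 0)"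
      by (simp add: J_def I_def Lp_norm_def epowr_mult epowr_ennreal powr_powr)
    finally show ?thesis
      by (simp add: ennreal_mult mult.assoc)
  qed
  then show ?thesis
    using C by (intro that[of "C powr (1 / p) * 2 powr (1 / p)"]) auto
qed

section \<open>The weight produced by large scales\<close>

text \<open>The exponent beyond \<open>- n / p\<close> makes the weight \<open>p\<close>-integrable at infinity. Writing
  \<open>\<rho> powr - a\<close> with \<open>\<rho> = max l (norm x / R)\<close> as \<open>a\<close> times the integral of \<open>\<tau> powr (- a - 1)\<close> over
  \<open>\<tau> \<ge> \<rho>\<close> and interchanging the integrals leaves the volumes of the balls \<open>norm x \<le> R \<tau>\<close>,
  and the remaining integral over \<open>\<tau> \<ge> l\<close> is again a tail.\<close>

lemma Lp_norm_weight_le: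
  assumes "0 < p" "0 < s" "0 < R"
  obtains K where "0 < K" "\<And>l. 0 < l \<Longrightarrow>
    Lp_norm p (\<lambda>x :: real^'n. ennreal (max l (norm x / R) powr (- s - real CARD('n) / p))) \<le> ennreal (K * l powr - s)"
proof -
  define V where "V = unit_ball_vol (real CARD('n))"
  have V: "0 < V" by (simp add: V_def)
  define n where "n = real CARD('n)"
  have n: "0 < n" by (simp add: n_def)
  define a where "a = s * p + n"
  have a: "0 < a" using assms n by (simp add: a_def add_pos_pos)
  define C where "C = a * V * R powr n / (s * p)"
  have C: "0 < C" using a V assms by (simp add: C_def)
  have "Lp_norm p (\<lambda>x :: real^'n. ennreal (max l (norm x / R) powr (- s - n / p))) \<le> ennreal (C powr (1 / p) * l powr - s)"
    if l: "0 < l" for l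
  proof -
    have "(\<integral>\<^sup>+(x::real^'n). epowr (ennreal (max l (norm x / R) powr (- s - n / p))) p \<partial>lebesgue)
        = (\<integral>\<^sup>+(x::real^'n). ennreal a * (\<integral>\<^sup>+\<tau>. ennreal (\<tau> powr (- a - 1)) * indicator {max l (norm x / R)..} \<tau> \<partial>lborel) \<partial>lborel)"
      unfolding nn_integral_completion
    proof (rule nn_integral_cong)
      fix x :: "real^'n"
      have \<rho>: "0 < max l (norm x / R)" using l by simp
      have "epowr (ennreal (max l (norm x / R) powr (- s - n / p))) p = ennreal (max l (norm x / R) powr - a)"
        using assms by (simp add: epowr_ennreal powr_powr a_def left_diff_distrib)
      also have "\<dots> = ennreal a * ennreal (max l (norm x / R) powr - a / a)"
        using a by (simp add: ennreal_mult[symmetric])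
      also have "\<dots> = ennreal a * (\<integral>\<^sup>+\<tau>. ennreal (\<tau> powr (- a - 1)) * indicator {max l (norm x / R)..} \<tau> \<partial>lborel)"
        using nn_integral_powr_tail[OF a \<rho>] by (simp add: nn_integral_completion)
      finally show "epowr (ennreal (max l (norm x / R) powr (- s - n / p))) p
        = ennreal a * (\<integral>\<^sup>+\<tau>. ennreal (\<tau> powr (- a - 1)) * indicator {max l (norm x / R)..} \<tau> \<partial>lborel)" .
    qed
    also have "\<dots> = ennreal a * (\<integral>\<^sup>+(x::real^'n). \<integral>\<^sup>+\<tau>. ennreal (\<tau> powr (- a - 1)) * indicator {l..} \<tau> * indicator {z. norm (snd z) \<le> R * fst z} (\<tau>, x) \<partial>lborel \<partial>lborel)"
    proof -
      have "(\<lambda>x :: real^'n. \<integral>\<^sup>+\<tau>. ennreal (\<tau> powr (- a - 1)) * indicator {max l (norm x / R)..} \<tau> \<partial>lborel)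
          = (\<lambda>x. \<integral>\<^sup>+\<tau>. ennreal (\<tau> powr (- a - 1)) * indicator {l..} \<tau> * indicator {z. norm (snd z) \<le> R * fst z} (\<tau>, x) \<partial>lborel)"
        using assms by (intro ext nn_integral_cong) (auto simp: indicator_def field_simps)
      then show ?thesis
        using a by (simp add: nn_integral_cmult_pos)
    qed
    also have "(\<integral>\<^sup>+(x::real^'n). \<integral>\<^sup>+\<tau>. ennreal (\<tau> powr (- a - 1)) * indicator {l..} \<tau> * indicator {z. norm (snd z) \<le> R * fst z} (\<tau>, x) \<partial>lborel \<partial>lborel)
        = (\<integral>\<^sup>+\<tau>. \<integral>\<^sup>+(x::real^'n). ennreal (\<tau> powr (- a - 1)) * indicator {l..} \<tau> * indicator {z. norm (snd z) \<le> R * fst z} (\<tau>, x) \<partial>lborel \<partial>lborel)"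
      by (rule lborel_pair.Fubini') (simp add: borel_prod[symmetric] case_prod_beta)
    also have "\<dots> = (\<integral>\<^sup>+\<tau>. ennreal (V * R powr n) * (ennreal (\<tau> powr (- (s * p) - 1)) * indicator {l..} \<tau>) \<partial>lborel)"
    proof (rule nn_integral_cong)
      fix \<tau> :: real
      show "(\<integral>\<^sup>+(x::real^'n). ennreal (\<tau> powr (- a - 1)) * indicator {l..} \<tau> * indicator {z. norm (snd z) \<le> R * fst z} (\<tau>, x) \<partial>lborel)
        = ennreal (V * R powr n) * (ennreal (\<tau> powr (- (s * p) - 1)) * indicator {l..} \<tau>)"
      proof (cases "l \<le> \<tau>")
        case True
        then have \<tau>: "0 < \<tau>" using l by simp
        have "(\<integral>\<^sup>+(x::real^'n). ennreal (\<tau> powr (- a - 1)) * indicator {l..} \<tau> * indicator {z. norm (snd z) \<le> R * fst z} (\<tau>, x) \<partial>lborel)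
            = (\<integral>\<^sup>+(x::real^'n). ennreal (\<tau> powr (- a - 1)) * indicator (cball 0 (R * \<tau>)) x \<partial>lborel)"
          using True by (intro nn_integral_cong) (simp add: indicator_def)
        also have "\<dots> = ennreal (\<tau> powr (- a - 1)) * ennreal (V * (R * \<tau>) powr n)"
          using \<tau> assms by (subst nn_integral_cmult_indicator) (simp_all add: emeasure_cball V_def n_def powr_realpow)
        also have "\<dots> = ennreal (V * R powr n * \<tau> powr (- (s * p) - 1))"
        proof -
          have "\<tau> powr (- a - 1) * \<tau> powr n = \<tau> powr (- (s * p) - 1)"
          proof -
            have "- a - 1 + n = - (s * p) - 1"
              by (simp add: a_def)
            then show ?thesis
              by (metis powr_add)
          qed
          then have "\<tau> powr (- a - 1) * (V * (R * \<tau>) powr n) = V * R powr n * \<tau> powr (- (s * p) - 1)"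
            using \<tau> assms by (simp add: powr_mult)
          then show ?thesis
            using V by (simp add: ennreal_mult[symmetric])
        qed
        also have "\<dots> = ennreal (V * R powr n) * (ennreal (\<tau> powr (- (s * p) - 1)) * indicator {l..} \<tau>)"
          using True V by (simp add: ennreal_mult)
        finally show ?thesis .
      qed simp
    qed
    also have "\<dots> = ennreal (V * R powr n) * ennreal (l powr - (s * p) / (s * p))"
      using nn_integral_powr_tail[of "s * p" l] assms l by (simp add: nn_integral_cmult nn_integral_completion)
    also have "ennreal a * \<dots> = ennreal (C * l powr - (s * p))"
      using a V assms by (simp add: C_def ennreal_mult[symmetric])
    finally have "Lp_norm p (\<lambda>x :: real^'n. ennreal (max l (norm x / R) powr (- s - n / p)))
        = epowr (ennreal (C * l powr - (s * p))) (1 / p)"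
      by (simp add: Lp_norm_def)
    also have "\<dots> = ennreal (C powr (1 / p) * l powr - s)"
      using C assms by (simp add: epowr_ennreal powr_mult powr_powr)
    finally show ?thesis by simp
  qed
  then show ?thesis
    using C unfolding n_def by (intro that[of "C powr (1 / p)"]) auto
qed

section \<open>Triebel-Lizorkin norms of functions with small support\<close>

text \<open>Differences commute with dilations up to rescaling of the step, so ball means at scale \<open>t\<close>
  become ball means at scale \<open>l t\<close>, and only the scales below \<open>l\<close> are left.\<close>

lemma TL_norm_dilate:
  fixes f :: "real^'n \<Rightarrow> complex"
  assumes "0 < p" "0 < q" "0 < l"
  shows "TL_norm r s p q (\<lambda>x. f (l *\<^sub>R x)) =
    ennreal (l powr (- real CARD('n) / p)) * Lp_norm p (\<lambda>x. ennreal (norm (f x))) +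
    ennreal (l powr (s - real CARD('n) / p)) * Lp_norm p (\<lambda>x. scale_norm s q l (\<lambda>t. ball_mean r p t f x))"
proof -
  have "TL_inner r s p q (\<lambda>x. f (l *\<^sub>R x)) x
      = ennreal (l powr s) * scale_norm s q l (\<lambda>t. ball_mean r p t f (l *\<^sub>R x))" for x
  proof -
    have "TL_inner r s p q (\<lambda>x. f (l *\<^sub>R x)) x = scale_norm s q 1 (\<lambda>t. ball_mean r p (l * t) f (l *\<^sub>R x))"
      unfolding TL_inner_eq_scale_norm using assms
      by (intro antisym scale_norm_mono) (simp_all add: ball_mean_dilate)
    also have "\<dots> = ennreal (l powr s) * scale_norm s q l (\<lambda>t. ball_mean r p t f (l *\<^sub>R x))"
      using assms by (intro scale_norm_dilate[where D = "\<lambda>t. ball_mean r p t f (l *\<^sub>R x)"])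
    finally show ?thesis .
  qed
  then have "Lp_norm p (TL_inner r s p q (\<lambda>x. f (l *\<^sub>R x)))
      = Lp_norm p (\<lambda>x. ennreal (l powr s) * scale_norm s q l (\<lambda>t. ball_mean r p t f (l *\<^sub>R x)))"
    by presburger
  also have "\<dots> = ennreal (l powr s) * Lp_norm p (\<lambda>x. scale_norm s q l (\<lambda>t. ball_mean r p t f (l *\<^sub>R x)))"
    using assms by (intro Lp_norm_cmult) auto
  also have "\<dots> = ennreal (l powr s) * (ennreal (l powr (- real CARD('n) / p)) *
      Lp_norm p (\<lambda>x. scale_norm s q l (\<lambda>t. ball_mean r p t f x)))"
    using Lp_norm_dilate[OF assms(1,3), of "\<lambda>x. scale_norm s q l (\<lambda>t. ball_mean r p t f x)"] by simp
  also have "\<dots> = ennreal (l powr (s - real CARD('n) / p)) *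
      Lp_norm p (\<lambda>x. scale_norm s q l (\<lambda>t. ball_mean r p t f x))"
    using assms by (simp add: mult.assoc[symmetric] ennreal_mult[symmetric] powr_add[symmetric])
  finally show ?thesis
    using Lp_norm_dilate[OF assms(1,3), of "\<lambda>x. ennreal (norm (f x))"] by (simp add: TL_norm_def)
qed

text \<open>A Poincare-type inequality for functions supported in the ball of radius \<open>l\<close>: at the scales
  comparable to \<open>l\<close> the ball means already dominate the function pointwise. The condition
  \<open>4 * l \<le> 1\<close> keeps these scales in the range of the norm.\<close>

lemma Lp_norm_le_TL_inner:
  assumes "0 < p" "0 < q" "0 < s"
  obtains k where "0 < k" "\<And>(f :: real^'n \<Rightarrow> complex) l.
    (AE y in lebesgue. y \<notin> ball 0 l \<longrightarrow> f y = 0) \<Longrightarrow> 0 < l \<Longrightarrow> 4 * l \<le> 1 \<Longrightarrow>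
    ennreal (k * l powr - s) * Lp_norm p (\<lambda>x. ennreal (norm (f x))) \<le> Lp_norm p (TL_inner r s p q f)"
proof -
  obtain k1 where k1: "0 < k1" "\<And>(f :: real^'n \<Rightarrow> complex) l t x.
      (AE y in lebesgue. y \<notin> ball 0 l \<longrightarrow> f y = 0) \<Longrightarrow> 0 < l \<Longrightarrow> 3 * l \<le> t \<Longrightarrow> t \<le> 4 * l \<Longrightarrow> x \<in> ball 0 l \<Longrightarrow>
      ennreal (k1 * norm (f x)) \<le> ball_mean r p t f x"
    using ball_mean_lower[OF assms(1), where r = r and ?'n = 'n] by blast
  obtain k2 where k2: "0 < k2" "\<And>D l m. 0 < l \<Longrightarrow> 4 * l \<le> 1 \<Longrightarrow>
      (\<And>t. 3 * l \<le> t \<Longrightarrow> t \<le> 4 * l \<Longrightarrow> m \<le> D t) \<Longrightarrow> ennreal (k2 * l powr - s) * m \<le> scale_norm s q 1 D"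
    using scale_norm_lower[OF assms(2,3)] by blast
  have "ennreal (k2 * k1 * l powr - s) * Lp_norm p (\<lambda>x. ennreal (norm (f x))) \<le> Lp_norm p (TL_inner r s p q f)"
    if supp: "AE y in lebesgue. y \<notin> ball 0 l \<longrightarrow> f y = 0" and l: "0 < l" "4 * l \<le> 1"
    for f :: "real^'n \<Rightarrow> complex" and l
  proof -
    have "AE x in lebesgue. ennreal (k2 * k1 * l powr - s) * ennreal (norm (f x)) \<le> TL_inner r s p q f x"
      using supp
    proof eventually_elim
      case (elim x)
      show ?case
      proof (cases "x \<in> ball 0 l")
        case True
        have "ennreal (k2 * l powr - s) * ennreal (k1 * norm (f x)) \<le> TL_inner r s p q f x"
          unfolding TL_inner_eq_scale_norm using l True by (intro k2(2) k1(2)[OF supp]) auto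
        moreover have "ennreal (k2 * k1 * l powr - s) * ennreal (norm (f x))
            = ennreal (k2 * l powr - s) * ennreal (k1 * norm (f x))"
          using k1(1) k2(1) by (simp add: ennreal_mult[symmetric] mult_ac)
        ultimately show ?thesis by simp
      qed (use elim in simp)
    qed
    then have "Lp_norm p (\<lambda>x. ennreal (k2 * k1 * l powr - s) * ennreal (norm (f x))) \<le> Lp_norm p (TL_inner r s p q f)"
      by (rule Lp_norm_mono_AE[OF assms(1)])
    then show ?thesis
      using k1(1) k2(1) assms(1) by (simp add: Lp_norm_cmult)
  qed
  then show ?thesis
    using k1(1) k2(1) by (intro that[of "k2 * k1"]) auto
qed

text \<open>The ball means at scales up to \<open>l\<close> are kept. At larger scales they are dominated, up to
  factors, by the constant \<open>norm (f x)\<close> and by \<open>N t powr (- n / p)\<close>, the latter only for \<open>t\<close> above both \<open>l\<close> and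
  \<open>norm x / (r + 1)\<close>. Both are tails in \<open>t\<close>, explicit and measurable, so that they can be split off from
  the part that is kept.\<close>

lemma TL_inner_le_pointwise:
  assumes "0 < p" "0 < q" "0 < s"
  obtains C where "0 < C" "\<And>(f :: real^'n \<Rightarrow> complex) l N x.
    f \<in> borel_measurable lebesgue \<Longrightarrow> (AE y in lebesgue. y \<notin> ball 0 l \<longrightarrow> f y = 0) \<Longrightarrow> 0 < l \<Longrightarrow>
    0 \<le> N \<Longrightarrow> Lp_norm p (\<lambda>y. ennreal (norm (f y))) = ennreal N \<Longrightarrow>
    TL_inner r s p q f x \<le> ennreal C * (scale_norm s q l (\<lambda>t. ball_mean r p t f x) +
      (ennreal (l powr - s) * ennreal (norm (f x)) +
       ennreal N * ennreal (max l (norm x / real (r + 1)) powr (- s - real CARD('n) / p))))"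
proof -
  define n where "n = real CARD('n)"
  obtain K where K: "0 < K" "\<And>(f :: real^'n \<Rightarrow> complex) l t x.
      f \<in> borel_measurable lebesgue \<Longrightarrow> (AE y in lebesgue. y \<notin> ball 0 l \<longrightarrow> f y = 0) \<Longrightarrow> 0 < l \<Longrightarrow> l \<le> t \<Longrightarrow>
      ball_mean r p t f x \<le> ennreal K * (ennreal (norm (f x)) +
        (if norm x \<le> real (r + 1) * t then ennreal (t powr (- n / p)) * Lp_norm p (\<lambda>y. ennreal (norm (f y))) else 0))"
    unfolding n_def using ball_mean_upper[OF assms(1), where r = r and ?'n = 'n] by blast
  obtain A where A: "0 < A" "\<And>L D E. E \<in> borel_measurable lebesgue \<Longrightarrow>
      scale_norm s q L (\<lambda>t. D t + E t) \<le> ennreal A * (scale_norm s q L D + scale_norm s q L E)"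
    using scale_norm_add_le[OF assms(2), where s = s] by blast
  obtain T0 where T0: "0 < T0" "\<And>L M \<rho>. 0 \<le> M \<Longrightarrow> 0 < \<rho> \<Longrightarrow>
      scale_norm s q L (\<lambda>t. if \<rho> \<le> t then ennreal (M * t powr - 0) else 0) \<le> ennreal (T0 * (M * \<rho> powr (- s - 0)))"
    using scale_norm_tail[OF assms(2,3), of 0] by blast
  have np: "0 \<le> n / p"
    using assms(1) by (simp add: n_def)
  obtain T1 where T1: "0 < T1" "\<And>L M \<rho>. 0 \<le> M \<Longrightarrow> 0 < \<rho> \<Longrightarrow>
      scale_norm s q L (\<lambda>t. if \<rho> \<le> t then ennreal (M * t powr - (n / p)) else 0)
        \<le> ennreal (T1 * (M * \<rho> powr (- s - n / p)))"
    using scale_norm_tail[OF assms(2,3) np] by blast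
  define C where "C = A + A * (A * (T0 * K)) + A * (A * (T1 * K))"
  have C: "0 < C"
    using A(1) T0(1) T1(1) K(1) by (simp add: C_def add_pos_pos)
  have "TL_inner r s p q f x \<le> ennreal C * (scale_norm s q l (\<lambda>t. ball_mean r p t f x) +
      (ennreal (l powr - s) * ennreal (norm (f x)) +
       ennreal N * ennreal (max l (norm x / real (r + 1)) powr (- s - n / p))))"
    if f: "f \<in> borel_measurable lebesgue" and supp: "AE y in lebesgue. y \<notin> ball 0 l \<longrightarrow> f y = 0"
      and l: "0 < l" and N: "0 \<le> N" "Lp_norm p (\<lambda>y. ennreal (norm (f y))) = ennreal N"
    for f :: "real^'n \<Rightarrow> complex" and l N x
  proof -
    let ?D = "\<lambda>t. ball_mean r p t f x"
    \<comment> \<open>Below the scale \<open>\<rho>\<close> the translates do not reach the support.\<close>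
    define \<rho> where "\<rho> = max l (norm x / real (r + 1))"
    have \<rho>: "0 < \<rho>" using l by (simp add: \<rho>_def)
    define D1 where "D1 = (\<lambda>t. if t \<le> l then ?D t else 0)"
    define E0 where "E0 = (\<lambda>t. if l \<le> t then ennreal (K * norm (f x) * t powr - 0) else 0)"
    define E1 where "E1 = (\<lambda>t. if \<rho> \<le> t then ennreal (K * N * t powr - (n / p)) else 0)"
    have E: "E0 \<in> borel_measurable lebesgue" "E1 \<in> borel_measurable lebesgue"
      unfolding E0_def E1_def by (rule measurable_completion; measurable)+
    have "?D t \<le> D1 t + (E0 t + E1 t)" if t: "0 < t" for t
    proof (cases "t \<le> l")
      case False
      have "?D t \<le> ennreal K * (ennreal (norm (f x)) +
          (if norm x \<le> real (r + 1) * t then ennreal (t powr (- n / p)) * ennreal N else 0))"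
      proof -
        have "l \<le> t" using False by simp
        from K(2)[OF f supp l this, of x] show ?thesis unfolding N(2) .
      qed
      also have "\<dots> = ennreal (K * norm (f x)) +
          (if norm x \<le> real (r + 1) * t then ennreal (K * N * t powr (- n / p)) else 0)"
        using K(1) N(1) by (simp add: distrib_left ennreal_mult[symmetric] mult_ac)
      also have "\<dots> = E0 t + E1 t"
        using False t by (simp add: E0_def E1_def \<rho>_def field_simps)
      finally show ?thesis
        using False by (simp add: D1_def)
    qed (simp add: D1_def)
    then have "TL_inner r s p q f x \<le> scale_norm s q 1 (\<lambda>t. D1 t + (E0 t + E1 t))"
      unfolding TL_inner_eq_scale_norm by (intro scale_norm_mono) auto
    also have "\<dots> \<le> ennreal A * (scale_norm s q 1 D1 + scale_norm s q 1 (\<lambda>t. E0 t + E1 t))"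
      using E by (intro A(2)) auto
    also have "\<dots> \<le> ennreal A * (scale_norm s q 1 D1 + ennreal A * (scale_norm s q 1 E0 + scale_norm s q 1 E1))"
      using E by (intro mult_left_mono add_left_mono A(2)) auto
    also have "\<dots> \<le> ennreal A * (scale_norm s q l ?D + ennreal A * (ennreal (T0 * (K * norm (f x) * l powr (- s - 0)))
        + ennreal (T1 * (K * N * \<rho> powr (- s - n / p)))))"
      unfolding E0_def E1_def D1_def using l \<rho> K(1) N(1) assms(2)
      by (intro mult_left_mono add_mono T0(2) T1(2) scale_norm_cutoff_le) auto
    also have "\<dots> = ennreal A * scale_norm s q l ?D
        + (ennreal (A * (A * (T0 * K))) * (ennreal (l powr - s) * ennreal (norm (f x)))
        + ennreal (A * (A * (T1 * K))) * (ennreal N * ennreal (\<rho> powr (- s - n / p))))"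
      using A(1) T0(1) T1(1) K(1) N(1) by (simp add: distrib_left ennreal_mult mult_ac)
    also have "\<dots> \<le> ennreal C * scale_norm s q l ?D + (ennreal C * (ennreal (l powr - s) * ennreal (norm (f x)))
        + ennreal C * (ennreal N * ennreal (\<rho> powr (- s - n / p))))"
      using A(1) T0(1) T1(1) K(1) by (intro add_mono mult_right_mono ennreal_leI) (simp_all add: C_def)
    finally show ?thesis
      by (simp add: distrib_left \<rho>_def)
  qed
  then show ?thesis
    using C unfolding n_def by (intro that[of C]) auto
qed

text \<open>For functions supported in the ball of radius \<open>l\<close> the scales above \<open>l\<close> are controlled by
  \<open>l powr - s\<close> times the \<open>L\<^sub>p\<close>-norm. This is the pointwise estimate, integrated: the weight
  produced by the translates has \<open>L\<^sub>p\<close>-norm at most a multiple of \<open>l powr - s\<close>.\<close>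

lemma TL_inner_le_small_scales:
  assumes "0 < p" "0 < q" "0 < s"
  obtains K where "0 < K" "\<And>(f :: real^'n \<Rightarrow> complex) l.
    f \<in> Lp_space p \<Longrightarrow> (AE y in lebesgue. y \<notin> ball 0 l \<longrightarrow> f y = 0) \<Longrightarrow> 0 < l \<Longrightarrow>
    Lp_norm p (TL_inner r s p q f) \<le> ennreal K * (Lp_norm p (\<lambda>x. scale_norm s q l (\<lambda>t. ball_mean r p t f x))
      + ennreal (l powr - s) * Lp_norm p (\<lambda>x. ennreal (norm (f x))))"
proof -
  obtain C where C: "0 < C" "\<And>(f :: real^'n \<Rightarrow> complex) l N x.
      f \<in> borel_measurable lebesgue \<Longrightarrow> (AE y in lebesgue. y \<notin> ball 0 l \<longrightarrow> f y = 0) \<Longrightarrow> 0 < l \<Longrightarrow>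
      0 \<le> N \<Longrightarrow> Lp_norm p (\<lambda>y. ennreal (norm (f y))) = ennreal N \<Longrightarrow>
      TL_inner r s p q f x \<le> ennreal C * (scale_norm s q l (\<lambda>t. ball_mean r p t f x) +
        (ennreal (l powr - s) * ennreal (norm (f x)) +
         ennreal N * ennreal (max l (norm x / real (r + 1)) powr (- s - real CARD('n) / p))))"
    using TL_inner_le_pointwise[OF assms, where r = r and ?'n = 'n] by blast
  obtain W where W: "0 < W" "\<And>l. 0 < l \<Longrightarrow>
      Lp_norm p (\<lambda>x :: real^'n. ennreal (max l (norm x / real (r + 1)) powr (- s - real CARD('n) / p))) \<le> ennreal (W * l powr - s)"
    using Lp_norm_weight_le[OF assms(1,3), of "real (r + 1)", where ?'n = 'n] by auto
  define c where "c = 2 * 2 powr (1 / p)"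
  have c: "0 < c" by (simp add: c_def)
  define K where "K = C * c * (1 + c * (1 + W))"
  have "Lp_norm p (TL_inner r s p q f) \<le> ennreal K * (Lp_norm p (\<lambda>x. scale_norm s q l (\<lambda>t. ball_mean r p t f x))
      + ennreal (l powr - s) * Lp_norm p (\<lambda>x. ennreal (norm (f x))))"
    if f: "f \<in> Lp_space p" and supp: "AE y in lebesgue. y \<notin> ball 0 l \<longrightarrow> f y = 0" and l: "0 < l"
    for f :: "real^'n \<Rightarrow> complex" and l
  proof -
    have [measurable]: "f \<in> borel_measurable lebesgue"
      using f by (simp add: Lp_space_def)
    define X where "X = Lp_norm p (\<lambda>x. ennreal (norm (f x)))"
    define N where "N = enn2real X"
    have N: "0 \<le> N" "X = ennreal N"
      using f by (auto simp: N_def X_def Lp_space_def)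
    define S where "S = (\<lambda>x. scale_norm s q l (\<lambda>t. ball_mean r p t f x))"
    define P where "P = (\<lambda>x. ennreal (l powr - s) * ennreal (norm (f x)))"
    define w where "w = (\<lambda>x :: real^'n. ennreal (max l (norm x / real (r + 1)) powr (- s - real CARD('n) / p)))"
    have [measurable]: "P \<in> borel_measurable lebesgue"
      unfolding P_def by measurable
    have "w \<in> borel_measurable lborel"
      unfolding w_def by measurable
    then have [measurable]: "w \<in> borel_measurable lebesgue"
      by (rule measurable_completion)
    have "Lp_norm p (TL_inner r s p q f) \<le> Lp_norm p (\<lambda>x. ennreal C * (S x + (P x + ennreal N * w x)))"
    proof (intro Lp_norm_mono_AE AE_I2)
      show "TL_inner r s p q f x \<le> ennreal C * (S x + (P x + ennreal N * w x))" for x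
        unfolding S_def P_def w_def using N(2)
        by (intro C(2)[OF _ supp l N(1)]) (simp_all add: X_def)
    qed (use assms(1) in auto)
    also have "\<dots> = ennreal C * Lp_norm p (\<lambda>x. S x + (P x + ennreal N * w x))"
      using C(1) assms(1) by (intro Lp_norm_cmult) auto
    also have "\<dots> \<le> ennreal C * (ennreal c * (Lp_norm p S + Lp_norm p (\<lambda>x. P x + ennreal N * w x)))"
      unfolding c_def using assms(1) by (intro mult_left_mono Lp_norm_add_le) measurable
    also have "\<dots> \<le> ennreal C * (ennreal c * (Lp_norm p S + ennreal c * (Lp_norm p P + Lp_norm p (\<lambda>x. ennreal N * w x))))"
      unfolding c_def using assms(1) by (intro mult_left_mono add_left_mono Lp_norm_add_le) measurable
    also have "\<dots> \<le> ennreal C * (ennreal c * (Lp_norm p S + ennreal c * (ennreal (l powr - s) * X + X * ennreal (W * l powr - s))))"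
    proof (intro mult_left_mono add_left_mono add_mono)
      show "Lp_norm p P \<le> ennreal (l powr - s) * X"
        unfolding P_def X_def using assms(1) by (simp add: Lp_norm_cmult)
      have "Lp_norm p (\<lambda>x. ennreal N * w x) = X * Lp_norm p w"
        using assms(1) N by (simp add: Lp_norm_cmult)
      also have "\<dots> \<le> X * ennreal (W * l powr - s)"
        unfolding w_def using l by (intro mult_left_mono W(2)) auto
      finally show "Lp_norm p (\<lambda>x. ennreal N * w x) \<le> X * ennreal (W * l powr - s)" .
    qed auto
    also have "\<dots> = ennreal (C * c) * Lp_norm p S + ennreal (C * c * (c * (1 + W))) * (ennreal (l powr - s) * X)"
      using C(1) c W(1) by (simp add: ennreal_mult ennreal_plus distrib_left distrib_right mult_ac)
    also have "\<dots> \<le> ennreal K * Lp_norm p S + ennreal K * (ennreal (l powr - s) * X)"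
      unfolding K_def using C(1) c W(1)
      by (intro add_mono mult_right_mono ennreal_leI mult_left_mono) (simp_all add: distrib_left)
    finally show ?thesis
      by (simp add: distrib_left S_def X_def)
  qed
  moreover have "0 < K"
    using C(1) c W(1) by (simp add: K_def add_pos_pos)
  ultimately show ?thesis
    by (intro that[of K]) auto
qed

section \<open>Dilation of functions with small support\<close>

theorem theorem2p4:
  fixes p s :: real and q :: ennreal and r :: nat
  assumes "0 < p" and "0 < q" and "0 < s" and "s < real r"
  shows "\<exists>c1 c2 :: real. 0 < c1 \<and> 0 < c2 \<and>
    (\<forall>l :: real. \<forall>f :: real^'n \<Rightarrow> complex.
       0 < l \<longrightarrow> l \<le> 1 \<longrightarrow> f \<in> TL_space r s p q \<longrightarrow> ess_supp f \<subseteq> ball 0 l \<longrightarrow>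
         ennreal (c1 * l powr (s - real CARD('n) / p)) * TL_norm r s p q f
           \<le> TL_norm r s p q (\<lambda>x. f (l *\<^sub>R x)) \<and>
         TL_norm r s p q (\<lambda>x. f (l *\<^sub>R x))
           \<le> ennreal (c2 * l powr (s - real CARD('n) / p)) * TL_norm r s p q f)"
proof -
  define n where "n = real CARD('n)"
  obtain k where k: "0 < k" "\<And>(f :: real^'n \<Rightarrow> complex) l.
      (AE y in lebesgue. y \<notin> ball 0 l \<longrightarrow> f y = 0) \<Longrightarrow> 0 < l \<Longrightarrow> 4 * l \<le> 1 \<Longrightarrow>
      ennreal (k * l powr - s) * Lp_norm p (\<lambda>x. ennreal (norm (f x))) \<le> Lp_norm p (TL_inner r s p q f)"
    using Lp_norm_le_TL_inner[OF assms(1-3), where r = r and ?'n = 'n] by blast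
  obtain K where K: "0 < K" "\<And>(f :: real^'n \<Rightarrow> complex) l.
      f \<in> Lp_space p \<Longrightarrow> (AE y in lebesgue. y \<notin> ball 0 l \<longrightarrow> f y = 0) \<Longrightarrow> 0 < l \<Longrightarrow>
      Lp_norm p (TL_inner r s p q f) \<le> ennreal K * (Lp_norm p (\<lambda>x. scale_norm s q l (\<lambda>t. ball_mean r p t f x))
        + ennreal (l powr - s) * Lp_norm p (\<lambda>x. ennreal (norm (f x))))"
    using TL_inner_le_small_scales[OF assms(1-3), where r = r and ?'n = 'n] by blast
  \<comment> \<open>\<open>1 / k\<close> serves \<open>l \<le> 1 / 4\<close>, \<open>4 powr s\<close> serves \<open>l > 1 / 4\<close>, and the summand 1 the square function.\<close>
  define c2 where "c2 = (1 / k + 4 powr s) + 1"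
  have "ennreal (1 / (1 + K) * l powr (s - n / p)) * TL_norm r s p q f \<le> TL_norm r s p q (\<lambda>x. f (l *\<^sub>R x)) \<and>
      TL_norm r s p q (\<lambda>x. f (l *\<^sub>R x)) \<le> ennreal (c2 * l powr (s - n / p)) * TL_norm r s p q f"
    if l: "0 < l" "l \<le> 1" and f: "f \<in> TL_space r s p q" and ess: "ess_supp f \<subseteq> ball 0 l"
    for l and f :: "real^'n \<Rightarrow> complex"
  proof -
    have fL: "f \<in> Lp_space p"
      using f by (simp add: TL_space_def)
    have supp: "AE y in lebesgue. y \<notin> ball 0 l \<longrightarrow> f y = 0"
      using AE_zero_outside_ess_supp[of f] by eventually_elim (use ess in blast)
    define X where "X = Lp_norm p (\<lambda>x. ennreal (norm (f x)))"
    define Y where "Y = Lp_norm p (TL_inner r s p q f)"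
    define S where "S = Lp_norm p (\<lambda>x. scale_norm s q l (\<lambda>t. ball_mean r p t f x))"
    have norm_f: "TL_norm r s p q f = X + Y"
      by (simp add: TL_norm_def X_def Y_def)
    have dil: "TL_norm r s p q (\<lambda>x. f (l *\<^sub>R x)) = ennreal (l powr (- n / p)) * X + ennreal (l powr (s - n / p)) * S"
      unfolding n_def X_def S_def using assms l by (intro TL_norm_dilate)
    have split: "l powr (- n / p) = l powr (s - n / p) * l powr - s"
      by (simp add: powr_add[symmetric])
    have c2: "0 < c2"
      using k(1) by (simp add: c2_def add_pos_pos)
    have SY: "S \<le> Y"
      unfolding S_def Y_def TL_inner_eq_scale_norm[abs_def] using assms(1) l
      by (intro Lp_norm_mono_AE AE_I2 scale_norm_mono) auto
    have "ennreal (l powr - s) * X \<le> ennreal (1 / k + 4 powr s) * (X + Y)"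
    proof (cases "4 * l \<le> 1")
      case True
      have "ennreal (l powr - s) * X = ennreal (1 / k) * (ennreal (k * l powr - s) * X)"
        using k(1) by (simp add: mult.assoc[symmetric] ennreal_mult[symmetric])
      also have "\<dots> \<le> ennreal (1 / k + 4 powr s) * (X + Y)"
      proof (rule mult_mono)
        show "ennreal (k * l powr - s) * X \<le> X + Y"
          using k(2)[OF supp l(1) True] unfolding X_def[symmetric] Y_def[symmetric]
          by (rule order_trans) simp
      qed (use k(1) in \<open>auto intro!: ennreal_leI\<close>)
      finally show ?thesis .
    next
      case False
      have "l powr - s \<le> (1 / 4) powr - s"
        using False assms(3) l by (intro powr_mono2') auto
      also have "(1 / 4 :: real) powr - s = 4 powr s"
        by (simp add: powr_minus powr_divide)
      also have "\<dots> \<le> 1 / k + 4 powr s"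
        using k(1) by simp
      finally show ?thesis
        by (intro mult_mono ennreal_leI) auto
    qed
    then have "ennreal (l powr - s) * X + S \<le> ennreal (1 / k + 4 powr s) * (X + Y) + ennreal 1 * (X + Y)"
      using SY by (intro add_mono) (auto intro: order_trans)
    also have "\<dots> = ennreal c2 * (X + Y)"
      unfolding c2_def using k(1) by (subst distrib_right[symmetric], subst ennreal_plus[symmetric]) auto
    finally have "ennreal (l powr (s - n / p)) * (ennreal (l powr - s) * X + S)
        \<le> ennreal (l powr (s - n / p)) * (ennreal c2 * (X + Y))"
      by (rule mult_left_mono) simp
    then have upper: "TL_norm r s p q (\<lambda>x. f (l *\<^sub>R x)) \<le> ennreal (c2 * l powr (s - n / p)) * TL_norm r s p q f"
      unfolding dil norm_f split using c2
      by (simp add: ennreal_mult distrib_left distrib_right mult_ac)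
    have "X \<le> ennreal (l powr - s) * X"
    proof -
      have "1 \<le> l powr - s"
        using l assms(3) by (simp add: powr_minus one_le_inverse powr_le1)
      then have "ennreal 1 * X \<le> ennreal (l powr - s) * X"
        by (intro mult_right_mono ennreal_leI) auto
      then show ?thesis by simp
    qed
    then have "X + Y \<le> ennreal 1 * (S + ennreal (l powr - s) * X) + ennreal K * (S + ennreal (l powr - s) * X)"
      using K(2)[OF fL supp l(1)] unfolding X_def[symmetric] Y_def[symmetric] S_def[symmetric]
      by (intro add_mono) (auto intro: order_trans)
    also have "\<dots> = ennreal (1 + K) * (S + ennreal (l powr - s) * X)"
      using K(1) by (subst distrib_right[symmetric], subst ennreal_plus[symmetric]) auto
    finally have "ennreal (1 / (1 + K) * l powr (s - n / p)) * (X + Y)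
        \<le> ennreal (1 / (1 + K) * l powr (s - n / p)) * (ennreal (1 + K) * (S + ennreal (l powr - s) * X))"
      by (rule mult_left_mono) simp
    also have "\<dots> = ennreal (l powr (s - n / p)) * (S + ennreal (l powr - s) * X)"
    proof -
      have "ennreal (1 / (1 + K) * l powr (s - n / p)) * ennreal (1 + K) = ennreal (l powr (s - n / p))"
        using K(1) by (subst ennreal_mult[symmetric]) auto
      then show ?thesis
        by (simp only: mult.assoc[symmetric])
    qed
    also have "\<dots> = TL_norm r s p q (\<lambda>x. f (l *\<^sub>R x))"
      unfolding dil split by (simp add: ennreal_mult distrib_left mult_ac add.commute)
    finally show ?thesis
      using upper unfolding norm_f by simp
  qed
  moreover have "0 < 1 / (1 + K)" "0 < c2"
    using K(1) k(1) by (simp_all add: c2_def add_pos_pos)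
  ultimately show ?thesis
    unfolding n_def by blast
qed

end
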